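(* Let $k\in\mathbb N$, $c\in\mathbb C\setminus(\mathbb S^1\cup\{0\})$, and let $$\xi=\lambda^{-1}\begin{pmatrix}0&1\\ c\,z^k&0\end{pmatrix}\mathrm dz,\qquad z\in\mathbb C,$$ be a radially symmetric potential. Let $F_\lambda\in\Lambda\mathrm{SU}(2)_\sigma$, $\lambda\in\mathbb S^1$, be an extended frame obtained from $\xi$, i.e. $\Phi=F_\lambda B$ is the Iwasawa decomposition of the solution of $\mathrm d\Phi=\Phi\xi$ with $\Phi(z_0)=\mathrm{id}$. Then the minimal Lagrangian surface $f^\lambda$ in $Q_2$ constructed from $(F_\lambda,F_{-i\lambda})$ has discrete rotational symmetries: for $\ell\in\{0,1,\dots,k+1\}$ and $R_\ell(z)=e^{2\pi i\ell/(k+2)}\bar z$, $$\hat{\mathfrak f}^\lambda(R_\ell(z),\overline{R_\ell(z)},\lambda)=\mathcal A_\ell\,\hat{\mathfrak f}^\lambda(\bar z,z,\lambda),\qquad \mathcal A_\ell=\begin{pmatrix}1&0&0&0\\ 0&1&0&0\\ 0&0&\cos\frac{2\pi\ell}{k+2}&-\sin\frac{2\pi\ell}{k+2}\\ 0&0&\sin\frac{2\pi\ell}{k+2}&\cos\frac{2\pi\ell}{k+2}\end{pmatrix},$$ where $\hat{\mathfrak f}^\lambda$ is the horizontal lift of $f^\lambda$. Moreover, the metric of the minimal Lagrangian surface $f^\lambda$ depends only on the radial direction, that is, on $|z|$. (Such a minimal Lagrangian surface $f^\lambda$ is said to be radially symmetric.)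
   Context: $Q_2=\{[\boldsymbol z]\in\mathbb CP^3:\sum_{k=1}^4z_k^2=0\}$ with the metric induced from the Fubini–Study metric of holomorphic sectional curvature $4$ on $\mathbb CP^3$. $\Lambda\mathrm{SL}(2,\mathbb C)_\sigma$ is the (Banach) loop group of maps $g:\mathbb S^1\to\mathrm{SL}(2,\mathbb C)$ with $\sigma_3g(\lambda)\sigma_3=g(-\lambda)$, $\sigma_3=\mathrm{diag}(1,-1)$; $\Lambda\mathrm{SU}(2)_\sigma$ is the subgroup of $\mathrm{SU}(2)$-valued loops, and $\Lambda^+\mathrm{SL}(2,\mathbb C)_\sigma$ the subgroup of loops extending holomorphically to $|\lambda|<1$. Iwasawa decomposition: $\Phi=F_\lambda B$ with $F_\lambda\in\Lambda\mathrm{SU}(2)_\sigma$ and $B\in\Lambda^+\mathrm{SL}(2,\mathbb C)_\sigma$ (unique when $B|_{\lambda=0}$ is required to be diagonal with positive entries). $z_0$ is the base point of the initial value problem. $F_{-i\lambda}$ denotes the value of the loop at $-i\lambda$. Surface: put $X^\lambda=F_\lambda F_{-i\lambda}^{-1}$, $Y^\lambda=iF_\lambda\sigma_3F_{-i\lambda}^{-1}$, $$\hat{\mathfrak f}^\lambda=\tfrac1{\sqrt2}\bigl(\operatorname{Re}X^\lambda_{11}+i\operatorname{Re}Y^\lambda_{11},\operatorname{Im}X^\lambda_{11}+i\operatorname{Im}Y^\lambda_{11},\operatorname{Re}X^\lambda_{12}+i\operatorname{Re}Y^\lambda_{12},\operatorname{Im}X^\lambda_{12}+i\operatorname{Im}Y^\lambda_{12}\bigr)^T\in\mathbb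 C^4,\qquad f^\lambda=[\hat{\mathfrak f}^\lambda].$$ The notation $\hat{\mathfrak f}^\lambda(w,\bar w,\lambda)$ means the value of $\hat{\mathfrak f}^\lambda$ at the point $w\in\mathbb C$ and parameter $\lambda$; in particular $\hat{\mathfrak f}^\lambda(\bar z,z,\lambda)$ is the value at the point $\bar z$. The metric of $f^\lambda$ is written $2e^u\,\mathrm dz\,\mathrm d\bar z$.
   Formalization: The base point is taken to be z_0 = 0, i.e. Φ(0) = id; for small z_0 ≠ 0 the stated symmetry would force the lift to agree at z_0 and its rotated points, contradicting local injectivity. The extended frame is assumed C^1 in z, as holds for the normalised one. *)

theory Defs
  imports "HOL-Analysis.Analysis"
begin

section \<open>Twisted loop groups\<close>

definition sigma3 :: "complex^2^2" where
  "sigma3 = vector [vector [1, 0], vector [0, -1]]"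

definition conj_transpose :: "complex^2^2 \<Rightarrow> complex^2^2" where
  "conj_transpose A = (\<chi> i j. cnj (A $ j $ i))"

text \<open>
  A loop is a function on all of \<open>complex\<close> of which only the values on the unit circle
  \<open>sphere 0 1\<close> matter.  The Banach topology is that of uniform convergence on the circle.
  The usual smaller completions (Wiener algebra, Hoelder, Sobolev of order above 1/2) embed
  continuously into this one.
\<close>

definition loop_SL2 :: "(complex \<Rightarrow> complex^2^2) set" where
  "loop_SL2 = {g. continuous_on (sphere 0 1) g \<and>
     (\<forall>l\<in>sphere 0 1. det (g l) = 1 \<and> sigma3 ** g l ** sigma3 = g (- l))}"

definition loop_SU2 :: "(complex \<Rightarrow> complex^2^2) set" where
  "loop_SU2 = {g \<in> loop_SL2. \<forall>l\<in>sphere 0 1. g l ** conj_transpose (g l) = mat 1}"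

definition loop_plus_SL2 :: "(complex \<Rightarrow> complex^2^2) set" where
  "loop_plus_SL2 = {g \<in> loop_SL2. \<exists>G. continuous_on (cball 0 1) G \<and>
     (\<forall>i j. (\<lambda>l. G l $ i $ j) holomorphic_on ball 0 1) \<and> (\<forall>l\<in>sphere 0 1. G l = g l)}"

text \<open>
  Continuous (real) differentiability of a map from the plane into the loop group, written out
  for the topology of uniform convergence on the circle: the derivative in the point exists for
  every loop parameter and is jointly continuous in the point and the loop parameter.
\<close>

definition C1_into_loops :: "(complex \<Rightarrow> complex \<Rightarrow> complex^2^2) \<Rightarrow> bool" where
  "C1_into_loops F \<longleftrightarrow>
     (\<exists>D. (\<forall>z. \<forall>l\<in>sphere 0 1. ((\<lambda>w. F w l) has_derivative D z l) (at z)) \<and>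
          (\<forall>h. continuous_on (UNIV \<times> sphere 0 1) (\<lambda>(z, l). D z l h)))"

section \<open>The potential and the surface\<close>

text \<open>
  The matrix-valued 1-form: \<open>radial_potential k c z l h\<close> is its value at the point \<open>z\<close>, for the
  loop parameter \<open>l\<close>, on the tangent vector \<open>h\<close> (so \<open>h\<close> plays the role of \<open>dz\<close>).
\<close>

definition radial_potential ::
    "nat \<Rightarrow> complex \<Rightarrow> complex \<Rightarrow> complex \<Rightarrow> complex \<Rightarrow> complex^2^2" where
  "radial_potential k c z l h =
     vector [vector [0, inverse l * h], vector [inverse l * (c * z ^ k) * h, 0]]"

definition surf_X :: "(complex \<Rightarrow> complex \<Rightarrow> complex^2^2) \<Rightarrow> complex \<Rightarrow> complex \<Rightarrow> complex^2^2" where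
  "surf_X F l z = F z l ** matrix_inv (F z (- \<i> * l))"

definition surf_Y :: "(complex \<Rightarrow> complex \<Rightarrow> complex^2^2) \<Rightarrow> complex \<Rightarrow> complex \<Rightarrow> complex^2^2" where
  "surf_Y F l z = mat \<i> ** F z l ** sigma3 ** matrix_inv (F z (- \<i> * l))"

definition f_hat :: "(complex \<Rightarrow> complex \<Rightarrow> complex^2^2) \<Rightarrow> complex \<Rightarrow> complex \<Rightarrow> complex^4" where
  "f_hat F l z = complex_of_real (1 / sqrt 2) *s
     vector [Complex (Re (surf_X F l z $ 1 $ 1)) (Re (surf_Y F l z $ 1 $ 1)),
             Complex (Im (surf_X F l z $ 1 $ 1)) (Im (surf_Y F l z $ 1 $ 1)),
             Complex (Re (surf_X F l z $ 1 $ 2)) (Re (surf_Y F l z $ 1 $ 2)),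
             Complex (Im (surf_X F l z $ 1 $ 2)) (Im (surf_Y F l z $ 1 $ 2))]"

definition refl_rot :: "nat \<Rightarrow> nat \<Rightarrow> complex \<Rightarrow> complex" where
  "refl_rot k m z = exp (2 * of_real pi * \<i> * of_nat m / of_nat (k + 2)) * cnj z"

definition rot_matrix :: "nat \<Rightarrow> nat \<Rightarrow> complex^4^4" where
  "rot_matrix k m =
     (let t = 2 * pi * real m / real (k + 2)
      in vector [vector [1, 0, 0, 0],
                 vector [0, 1, 0, 0],
                 vector [0, 0, complex_of_real (cos t), - complex_of_real (sin t)],
                 vector [0, 0, complex_of_real (sin t), complex_of_real (cos t)]])"

section \<open>The quadric and minimal Lagrangian surfaces in it\<close>

text \<open>A point of the complex projective space is represented as the punctured line \<open>[v]\<close>.\<close>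

definition cp_class :: "complex^4 \<Rightarrow> (complex^4) set" where
  "cp_class v = {a *s v | a. a \<noteq> 0}"

definition Q2 :: "(complex^4) set set" where
  "Q2 = {cp_class v | v. v \<noteq> 0 \<and> (\<Sum>i\<in>UNIV. (v $ i)\<^sup>2) = 0}"

definition herm :: "complex^4 \<Rightarrow> complex^4 \<Rightarrow> complex" where
  "herm v w = (\<Sum>i\<in>UNIV. v $ i * cnj (w $ i))"

text \<open>
  The Fubini-Study Hermitian form on the tangent vectors at \<open>[p]\<close> represented by \<open>v\<close> and \<open>w\<close>,
  normalised so that the Hopf fibration of the unit 7-sphere is a Riemannian submersion, i.e.
  with holomorphic sectional curvature 4.  The real part is the metric and the imaginary part is,
  up to sign, the Kaehler form.
\<close>

definition fubini_study :: "complex^4 \<Rightarrow> complex^4 \<Rightarrow> complex^4 \<Rightarrow> complex" where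
  "fubini_study p v w = (herm v w * herm p p - herm v p * herm p w) / (herm p p)\<^sup>2"

text \<open>
  Pullbacks along the map \<open>z \<mapsto> [\<psi> z]\<close>; they do not depend on the choice of the lift \<open>\<psi>\<close>.
  The quadric carries the metric and the Kaehler form induced from the projective space.
\<close>

definition pullback_metric ::
    "(complex \<Rightarrow> complex^4) \<Rightarrow> complex \<Rightarrow> complex \<Rightarrow> complex \<Rightarrow> real" where
  "pullback_metric \<psi> z v w =
     Re (fubini_study (\<psi> z) (frechet_derivative \<psi> (at z) v) (frechet_derivative \<psi> (at z) w))"

definition pullback_kaehler ::
    "(complex \<Rightarrow> complex^4) \<Rightarrow> complex \<Rightarrow> complex \<Rightarrow> complex \<Rightarrow> real" where
  "pullback_kaehler \<psi> z v w =
     Im (fubini_study (\<psi> z) (frechet_derivative \<psi> (at z) v) (frechet_derivative \<psi> (at z) w))"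

definition horizontal_lift ::
    "(complex \<Rightarrow> complex^4) \<Rightarrow> (complex \<Rightarrow> (complex^4) set) \<Rightarrow> bool" where
  "horizontal_lift \<psi> f \<longleftrightarrow>
     (\<forall>z. f z = cp_class (\<psi> z) \<and> norm (\<psi> z) = 1 \<and> \<psi> differentiable (at z) \<and>
          (\<forall>h. herm (frechet_derivative \<psi> (at z) h) (\<psi> z) = 0))"

text \<open>The tangent space of the quadric at \<open>[p]\<close>, in horizontal representatives at \<open>p\<close>.\<close>

definition tangent_Q2 :: "complex^4 \<Rightarrow> (complex^4) set" where
  "tangent_Q2 p = {v. herm v p = 0 \<and> (\<Sum>i\<in>UNIV. v $ i * p $ i) = 0}"

definition second_deriv ::
    "(complex \<Rightarrow> complex^4) \<Rightarrow> complex \<Rightarrow> complex \<Rightarrow> complex \<Rightarrow> complex^4" where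
  "second_deriv \<psi> z v w =
     frechet_derivative (\<lambda>y. frechet_derivative \<psi> (at y) w) (at z) v"

text \<open>
  Vanishing of the mean curvature vector (in the quadric) of the immersion with horizontal lift
  \<open>\<psi>\<close>.  Along a horizontal lift the Levi-Civita connection of the quadric is the orthogonal
  projection of the flat derivative to the tangent space of the quadric.  So the pairing
  of the second fundamental form with a vector \<open>n\<close> of the quadric normal to the surface is the
  pairing of the second derivative of \<open>\<psi>\<close> with \<open>n\<close>; the trace is taken over an arbitrary
  orthonormal basis \<open>v, w\<close> of the parameter plane for the induced metric.
\<close>

definition zero_mean_curvature_Q2 :: "(complex \<Rightarrow> complex^4) \<Rightarrow> bool" where
  "zero_mean_curvature_Q2 \<psi> \<longleftrightarrow>
     (\<forall>z v w n.
        pullback_metric \<psi> z v v = 1 \<and> pullback_metric \<psi> z w w = 1 \<and>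
        pullback_metric \<psi> z v w = 0 \<and>
        n \<in> tangent_Q2 (\<psi> z) \<and>
        (\<forall>h. Re (herm (frechet_derivative \<psi> (at z) h) n) = 0)
        \<longrightarrow> Re (herm (second_deriv \<psi> z v v + second_deriv \<psi> z w w) n) = 0)"

definition minimal_lagrangian_Q2 :: "(complex \<Rightarrow> (complex^4) set) \<Rightarrow> bool" where
  "minimal_lagrangian_Q2 f \<longleftrightarrow>
     range f \<subseteq> Q2 \<and>
     (\<exists>\<psi>. horizontal_lift \<psi> f \<and>
          (\<forall>z h. (\<lambda>y. frechet_derivative \<psi> (at y) h) differentiable (at z)) \<and>
          (\<forall>z h. h \<noteq> 0 \<longrightarrow> pullback_metric \<psi> z h h > 0) \<and>
          (\<forall>z v w. pullback_kaehler \<psi> z v w = 0) \<and>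
          zero_mean_curvature_Q2 \<psi>)"

end

theory Submission
  imports Defs "HOL-Complex_Analysis.Conformal_Mappings"
begin

text \<open>
  Write \<open>e1, e2\<close> for the columns of the frame \<open>F\<close>.  Up to a unitary change of coordinates the
  lift of the surface is the tensor \<open>e2(\<lambda>) \<otimes> e1(-\<i>\<lambda>)\<close>.  Since \<open>B\<close> extends holomorphically to
  the disk and \<open>F\<close> is unitary, the Maurer-Cartan form of \<open>F\<close> is a Laurent polynomial in \<open>\<lambda>\<close> with
  off-diagonal entry \<open>\<lambda>\<^sup>-\<^sup>1 p dz - \<lambda> cnj (q dz)\<close>, where \<open>p = b\<^sup>2\<close>, \<open>q = c z\<^sup>k b\<^sup>-\<^sup>2\<close> and \<open>b\<close> is the upper
  left entry of \<open>B\<close> at \<open>\<lambda> = 0\<close>, and its diagonal does not depend on \<open>\<lambda>\<close>.  Hence the lift is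
  horizontal and conformal with factor \<open>\<bar>p\<bar>\<^sup>2 + \<bar>q\<bar>\<^sup>2\<close>, and the surface is Lagrangian.  Moreover \<open>p\<close>
  and \<open>q\<close> are holomorphic sections for the connection given by the diagonal, which yields minimality.

  If \<open>\<omega> = \<mu>\<epsilon>\<close> and \<open>\<omega>\<^sup>k\<^sup>+\<^sup>1 \<epsilon> = \<mu>\<close> are unit complex numbers, then
  \<open>\<Phi>(\<omega>z, \<mu>\<lambda>) = D \<Phi>(z, \<lambda>) D\<^sup>-\<^sup>1\<close> with \<open>D = diag(\<epsilon>, 1)\<close>, because both sides solve the same
  linear equation.  By the uniqueness of the Iwasawa decomposition up to a diagonal unitary
  factor, \<open>\<mu> = 1\<close> gives the discrete rotations, and arbitrary \<open>\<omega>\<close> makes \<open>\<bar>b\<bar>\<close> radial.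
\<close>

section \<open>The disk algebra\<close>

text \<open>Boundary values of the classical disk algebra. Only values on the circle are
  constrained, since loops are total functions whose other values carry no meaning.\<close>

definition disk_algebra :: "(complex \<Rightarrow> complex) set" where
  "disk_algebra = {g. \<exists>G. continuous_on (cball 0 1) G \<and> G holomorphic_on ball 0 1 \<and>
     (\<forall>l\<in>sphere 0 1. G l = g l)}"

text \<open>The zeroth Fourier coefficient. An integral, rather than the value of an extension at 0,
  also applies to \<open>g l * cnj (g l)\<close>, which need not extend to the disk.\<close>

definition circle_mean :: "(complex \<Rightarrow> complex) \<Rightarrow> complex" where
  "circle_mean g = integral {0..2 * pi} (\<lambda>t. g (cis t)) / (2 * pi)"

lemma disk_algebraI:
  assumes "continuous_on (cball 0 1) G" "G holomorphic_on ball 0 1"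
    and "\<And>l. l \<in> sphere 0 1 \<Longrightarrow> G l = g l"
  shows "g \<in> disk_algebra"
  using assms by (auto simp: disk_algebra_def)

lemma disk_algebraE:
  assumes "g \<in> disk_algebra"
  obtains G where "continuous_on (cball 0 1) G" "G holomorphic_on ball 0 1"
    "\<And>l. l \<in> sphere 0 1 \<Longrightarrow> G l = g l"
  using assms by (auto simp: disk_algebra_def)

lemma disk_algebra_cong:
  assumes "g \<in> disk_algebra" "\<And>l. l \<in> sphere 0 1 \<Longrightarrow> h l = g l"
  shows "h \<in> disk_algebra"
  using assms by (auto simp: disk_algebra_def)

lemma circle_mean_cong:
  assumes "\<And>l. l \<in> sphere 0 1 \<Longrightarrow> h l = g l"
  shows "circle_mean h = circle_mean g"
  by (simp add: circle_mean_def assms)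

lemma continuous_on_circle_param:
  fixes g :: "complex \<Rightarrow> 'a::topological_space"
  assumes "continuous_on (sphere 0 1) g"
  shows "continuous_on A (\<lambda>t. g (cis t))"
  by (rule continuous_on_compose2[OF assms]) (auto intro!: continuous_intros)

lemma disk_algebra_continuous:
  assumes "g \<in> disk_algebra"
  shows "continuous_on (sphere 0 1) g"
proof -
  obtain G where "continuous_on (cball 0 1) G" and eq: "\<And>l. l \<in> sphere 0 1 \<Longrightarrow> G l = g l"
    using disk_algebraE[OF assms] by metis
  then have "continuous_on (sphere 0 1) G"
    by (rule_tac continuous_on_subset) auto
  then show ?thesis by (rule continuous_on_eq) (rule eq)
qed

text \<open>Cauchy's formula at the centre. It turns the mean into evaluation at
  \<open>\<lambda> = 0\<close>, which is why the mean is additive and multiplicative on the disk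
  algebra.\<close>

lemma circle_mean_extension:
  assumes "continuous_on (cball 0 1) G" "G holomorphic_on ball 0 1"
    and "\<And>l. l \<in> sphere 0 1 \<Longrightarrow> G l = g l"
  shows "circle_mean g = G 0"
proof -
  have "((\<lambda>u. G u / (u - 0)) has_contour_integral (2 * of_real pi * \<i> * G 0)) (circlepath 0 1)"
    using assms by (intro Cauchy_integral_circlepath) auto
  then have "((\<lambda>t. G (cis t) / cis t * \<i> * cis t) has_integral (2 * of_real pi * \<i> * G 0)) {0..2*pi}"
    by (simp add: circlepath_def has_contour_integral_part_circlepath_iff)
  then have "((\<lambda>t. \<i> * g (cis t)) has_integral (\<i> * (2 * of_real pi * G 0))) {0..2*pi}"
    by (simp add: assms(3) mult_ac)
  then have "((\<lambda>t. -\<i> * (\<i> * g (cis t))) has_integral -\<i> * (\<i> * (2 * of_real pi * G 0))) {0..2*pi}"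
    by (rule has_integral_mult_right)
  then have "((\<lambda>t. g (cis t)) has_integral (2 * of_real pi * G 0)) {0..2*pi}"
    by (simp flip: mult.assoc)
  then show ?thesis
    by (simp add: circle_mean_def integral_unique)
qed

lemma disk_algebra_const [simp]: "(\<lambda>l. a) \<in> disk_algebra"
  by (rule disk_algebraI[of "\<lambda>l. a"]) auto

lemma disk_algebra_ident [simp]: "(\<lambda>l. l) \<in> disk_algebra"
  by (rule disk_algebraI[of "\<lambda>l. l"]) (auto intro!: continuous_intros)

lemma circle_mean_const [simp]: "circle_mean (\<lambda>l. a) = a"
  using circle_mean_extension[of "\<lambda>l. a"] by simp

lemma disk_algebra_add:
  assumes "g \<in> disk_algebra" "h \<in> disk_algebra"
  shows "(\<lambda>l. g l + h l) \<in> disk_algebra"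
    and "circle_mean (\<lambda>l. g l + h l) = circle_mean g + circle_mean h"
proof -
  obtain G where G: "continuous_on (cball 0 1) G" "G holomorphic_on ball 0 1"
    "\<And>l. l \<in> sphere 0 1 \<Longrightarrow> G l = g l" using disk_algebraE[OF assms(1)] by metis
  obtain H where H: "continuous_on (cball 0 1) H" "H holomorphic_on ball 0 1"
    "\<And>l. l \<in> sphere 0 1 \<Longrightarrow> H l = h l" using disk_algebraE[OF assms(2)] by metis
  have *: "continuous_on (cball 0 1) (\<lambda>l. G l + H l)" "(\<lambda>l. G l + H l) holomorphic_on ball 0 1"
    "\<And>l. l \<in> sphere 0 1 \<Longrightarrow> G l + H l = g l + h l"
    using G H by (auto intro!: continuous_intros holomorphic_intros)
  show "(\<lambda>l. g l + h l) \<in> disk_algebra"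
    by (rule disk_algebraI[OF *])
  show "circle_mean (\<lambda>l. g l + h l) = circle_mean g + circle_mean h"
    using circle_mean_extension[OF *] circle_mean_extension[OF G] circle_mean_extension[OF H] by simp
qed

lemma disk_algebra_mult:
  assumes "g \<in> disk_algebra" "h \<in> disk_algebra"
  shows "(\<lambda>l. g l * h l) \<in> disk_algebra"
    and "circle_mean (\<lambda>l. g l * h l) = circle_mean g * circle_mean h"
proof -
  obtain G where G: "continuous_on (cball 0 1) G" "G holomorphic_on ball 0 1"
    "\<And>l. l \<in> sphere 0 1 \<Longrightarrow> G l = g l" using disk_algebraE[OF assms(1)] by metis
  obtain H where H: "continuous_on (cball 0 1) H" "H holomorphic_on ball 0 1"
    "\<And>l. l \<in> sphere 0 1 \<Longrightarrow> H l = h l" using disk_algebraE[OF assms(2)] by metis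
  have *: "continuous_on (cball 0 1) (\<lambda>l. G l * H l)" "(\<lambda>l. G l * H l) holomorphic_on ball 0 1"
    "\<And>l. l \<in> sphere 0 1 \<Longrightarrow> G l * H l = g l * h l"
    using G H by (auto intro!: continuous_intros holomorphic_intros)
  show "(\<lambda>l. g l * h l) \<in> disk_algebra"
    by (rule disk_algebraI[OF *])
  show "circle_mean (\<lambda>l. g l * h l) = circle_mean g * circle_mean h"
    using circle_mean_extension[OF *] circle_mean_extension[OF G] circle_mean_extension[OF H] by simp
qed

lemma disk_algebra_minus:
  assumes "g \<in> disk_algebra"
  shows "(\<lambda>l. - g l) \<in> disk_algebra" and "circle_mean (\<lambda>l. - g l) = - circle_mean g"
  using disk_algebra_mult[OF disk_algebra_const[of "-1"] assms] by auto

lemma disk_algebra_diff: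
  assumes "g \<in> disk_algebra" "h \<in> disk_algebra"
  shows "(\<lambda>l. g l - h l) \<in> disk_algebra"
    and "circle_mean (\<lambda>l. g l - h l) = circle_mean g - circle_mean h"
  using disk_algebra_add[OF assms(1) disk_algebra_minus(1)[OF assms(2)]]
    disk_algebra_minus[OF assms(2)] by simp_all

lemmas disk_algebra_intros =
  disk_algebra_const disk_algebra_ident disk_algebra_add(1) disk_algebra_mult(1)
  disk_algebra_minus(1) disk_algebra_diff(1)

lemmas circle_mean_simps =
  disk_algebra_add(2) disk_algebra_mult(2) disk_algebra_minus(2) disk_algebra_diff(2)

lemma circle_mean_ident [simp]: "circle_mean (\<lambda>l. l) = 0"
  using circle_mean_extension[of "\<lambda>l. l"] by (simp add: continuous_on_id)

lemma disk_algebra_rotate: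
  assumes "g \<in> disk_algebra" and m: "norm m = 1"
  shows "(\<lambda>l. g (m * l)) \<in> disk_algebra" and "circle_mean (\<lambda>l. g (m * l)) = circle_mean g"
proof -
  obtain G where G: "continuous_on (cball 0 1) G" "G holomorphic_on ball 0 1"
    "\<And>l. l \<in> sphere 0 1 \<Longrightarrow> G l = g l" using disk_algebraE[OF assms(1)] by metis
  have "continuous_on (cball 0 1) (G \<circ> (*) m)"
    using m by (intro continuous_on_compose continuous_intros continuous_on_subset[OF G(1)])
      (auto simp: norm_mult)
  moreover have "(G \<circ> (*) m) holomorphic_on ball 0 1"
    using m by (intro holomorphic_on_compose holomorphic_intros holomorphic_on_subset[OF G(2)])
      (auto simp: norm_mult)
  ultimately have *: "continuous_on (cball 0 1) (\<lambda>l. G (m * l))"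
    "(\<lambda>l. G (m * l)) holomorphic_on ball 0 1"
    "\<And>l. l \<in> sphere 0 1 \<Longrightarrow> G (m * l) = g (m * l)"
    using G(3) m by (auto simp: o_def norm_mult)
  show "(\<lambda>l. g (m * l)) \<in> disk_algebra"
    by (rule disk_algebraI[OF *])
  show "circle_mean (\<lambda>l. g (m * l)) = circle_mean g"
    using circle_mean_extension[OF *] circle_mean_extension[OF G] by simp
qed

text \<open>Rotation by -1 preserves the mean and negates \<open>g\<close>. For twisted loops this
  makes the off-diagonal entries vanish at \<open>\<lambda> = 0\<close>.\<close>

lemma circle_mean_odd:
  assumes "g \<in> disk_algebra" and "\<And>l. l \<in> sphere 0 1 \<Longrightarrow> g (- l) = - g l"
  shows "circle_mean g = 0"
proof -
  have "circle_mean g = circle_mean (\<lambda>l. g (- 1 * l))"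
    using disk_algebra_rotate(2)[OF assms(1), of "-1"] by simp
  also have "\<dots> = circle_mean (\<lambda>l. - g l)"
    by (rule circle_mean_cong) (use assms(2) in auto)
  also have "\<dots> = - circle_mean g"
    by (rule disk_algebra_minus(2)[OF assms(1)])
  finally show ?thesis by simp
qed

lemma circle_mean_norm_power2_eq_0:
  assumes "continuous_on (sphere 0 1) g" and "circle_mean (\<lambda>l. g l * cnj (g l)) = 0"
    and l: "l \<in> sphere 0 1"
  shows "g l = 0"
proof -
  obtain t where t: "t \<in> {0..2*pi}" "l = cis t"
  proof -
    have "l = cis (Arg2pi l)" using l by (metis Arg2pi_eq cis_conv_exp dist_0_norm mem_sphere mult.commute mult_1 of_real_1)
    then show ?thesis using that[of "Arg2pi l"] Arg2pi[of l] by auto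
  qed
  have cont: "continuous_on (cbox 0 (2*pi)) (\<lambda>t. (norm (g (cis t)))\<^sup>2)"
    by (intro continuous_intros continuous_on_circle_param assms)
  then have "((\<lambda>t. (norm (g (cis t)))\<^sup>2) has_integral integral (cbox 0 (2*pi)) (\<lambda>t. (norm (g (cis t)))\<^sup>2))
      (cbox 0 (2*pi))"
    by (intro integrable_integral integrable_continuous)
  moreover from this have "((\<lambda>t. complex_of_real ((norm (g (cis t)))\<^sup>2)) has_integral
      of_real (integral (cbox 0 (2*pi)) (\<lambda>t. (norm (g (cis t)))\<^sup>2))) (cbox 0 (2*pi))"
    by (rule has_integral_of_real)
  then have "((\<lambda>t. g (cis t) * cnj (g (cis t))) has_integral
      of_real (integral (cbox 0 (2*pi)) (\<lambda>t. (norm (g (cis t)))\<^sup>2))) (cbox 0 (2*pi))"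
    unfolding complex_norm_square .
  then have "complex_of_real (integral (cbox 0 (2*pi)) (\<lambda>t. (norm (g (cis t)))\<^sup>2)) = 0"
    using assms(2) by (simp add: circle_mean_def integral_unique)
  ultimately have "((\<lambda>t. (norm (g (cis t)))\<^sup>2) has_integral 0) (cbox 0 (2*pi))"
    by simp
  from has_integral_0_cbox_imp_0[OF cont _ this, of t] t pi_gt_zero show ?thesis
    by (simp del: pi_gt_zero)
qed

text \<open>Plays the role of Liouville's theorem for a function that extends to both sides of the
  circle. Multiplicativity of the mean gives squared distance 0 in the mean between \<open>g\<close>
  and its mean.\<close>

lemma disk_algebra_cnj_imp_const:
  assumes g: "g \<in> disk_algebra" and g': "(\<lambda>l. cnj (g l)) \<in> disk_algebra" and l: "l \<in> sphere 0 1"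
  shows "g l = circle_mean g"
proof -
  define a where "a = circle_mean g"
  have "circle_mean (\<lambda>l. (g l - a) * (cnj (g l) - cnj a)) = 0"
    using g g' by (simp add: circle_mean_simps disk_algebra_intros a_def)
  then have "circle_mean (\<lambda>l. (g l - a) * cnj (g l - a)) = 0"
    by simp
  then have "g l - a = 0"
    by (intro circle_mean_norm_power2_eq_0[where g = "\<lambda>l. g l - a"] l)
       (use disk_algebra_continuous[OF g] in \<open>auto intro!: continuous_intros\<close>)
  then show ?thesis by (simp add: a_def)
qed

text \<open>Mean zero says that the extension vanishes at 0, so the quotient has a removable
  singularity there.\<close>

lemma disk_algebra_divide:
  assumes g: "g \<in> disk_algebra" and "circle_mean g = 0"
  shows "(\<lambda>l. g l / l) \<in> disk_algebra"
proof -
  obtain G where G: "continuous_on (cball 0 1) G" "G holomorphic_on ball 0 1"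
    "\<And>l. l \<in> sphere 0 1 \<Longrightarrow> G l = g l" using disk_algebraE[OF g] by metis
  have G0: "G 0 = 0" using circle_mean_extension[OF G] assms by simp
  define H where "H l = (if l = 0 then deriv G 0 else G l / l)" for l
  have hol: "H holomorphic_on ball 0 1"
    by (rule pole_theorem_0[OF G(2), of 0]) (auto simp: H_def G0)
  have "continuous_on (cball 0 1 - {0}) (\<lambda>l. G l / l)"
    by (intro continuous_intros continuous_on_subset[OF G(1)]) auto
  then have "continuous_on (cball 0 1 - {0}) H"
    by (rule continuous_on_eq) (auto simp: H_def)
  then have *: "continuous (at l within (cball 0 1 - {0})) H" if "l \<in> cball 0 1 - {0}" for l
    using that by (simp add: continuous_on_eq_continuous_within)
  \<comment> \<open>Holomorphy gives continuity at 0; away from 0, and up to the boundary circle,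
    the quotient formula gives it.\<close>
  have "continuous_on (cball 0 1) H"
    unfolding continuous_on_eq_continuous_within
  proof
    fix l :: complex assume l: "l \<in> cball 0 1"
    show "continuous (at l within cball 0 1) H"
    proof (cases "l = 0")
      case True
      then have "continuous (at l) H"
        using holomorphic_on_imp_continuous_on[OF hol] by (simp add: continuous_on_eq_continuous_at)
      then show ?thesis by (rule continuous_at_imp_continuous_at_within)
    next
      case False
      have "at l within (cball 0 1 - {0}) = at l within cball 0 1"
        by (rule at_within_nhd[of l "- {0}"]) (use False in auto)
      then show ?thesis using *[of l] False l by simp
    qed
  qed
  then show ?thesis
    using hol by (rule disk_algebraI) (use G(3) in \<open>auto simp: H_def\<close>)
qed

text \<open>By the maximum principle the extensions are uniformly Cauchy on the closed disk as soon
  as the boundary values are so on the circle.\<close>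

lemma disk_algebra_uniform_limit:
  fixes g :: "nat \<Rightarrow> complex \<Rightarrow> complex"
  assumes g: "\<And>n. g n \<in> disk_algebra" and lim: "uniform_limit (sphere 0 1) g h sequentially"
  shows "h \<in> disk_algebra"
proof -
  have "\<forall>n. \<exists>G. continuous_on (cball 0 1) G \<and> G holomorphic_on ball 0 1 \<and>
     (\<forall>l\<in>sphere 0 1. G l = g n l)"
    using g by (simp add: disk_algebra_def)
  then obtain G where cont: "\<And>n. continuous_on (cball 0 1) (G n)"
    and hol: "\<And>n. G n holomorphic_on ball 0 1" and eq: "\<And>n l. l \<in> sphere 0 1 \<Longrightarrow> G n l = g n l"
    by metis
  have "uniformly_Cauchy_on (sphere 0 1) g"
    using lim uniformly_convergent_Cauchy uniformly_convergent_on_def by blast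
  have "uniformly_Cauchy_on (cball 0 1) G"
    unfolding uniformly_Cauchy_on_def
  proof (intro allI impI)
    fix e :: real assume "e > 0"
    then obtain M where M: "\<And>l m n. l \<in> sphere 0 1 \<Longrightarrow> m \<ge> M \<Longrightarrow> n \<ge> M \<Longrightarrow> dist (g m l) (g n l) < e/2"
      using \<open>uniformly_Cauchy_on (sphere 0 1) g\<close> unfolding uniformly_Cauchy_on_def
      by (metis half_gt_zero)
    have "dist (G m z) (G n z) < e" if "m \<ge> M" "n \<ge> M" "z \<in> cball 0 1" for m n z
    proof -
      have "norm (G m z - G n z) \<le> e/2"
      proof (rule maximum_modulus_frontier[where f = "\<lambda>z. G m z - G n z" and S = "cball 0 1" and \<xi> = z])
        show "(\<lambda>z. G m z - G n z) holomorphic_on interior (cball 0 1)"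
          using hol by (auto intro!: holomorphic_intros)
        show "continuous_on (closure (cball 0 1)) (\<lambda>z. G m z - G n z)"
          using cont by (auto intro!: continuous_intros)
        show "norm (G m z - G n z) \<le> e/2" if "z \<in> frontier (cball 0 1)" for z
          using M[of z m n] that \<open>m \<ge> M\<close> \<open>n \<ge> M\<close> eq[of z] by (auto simp: dist_norm)
      qed (use that in auto)
      then show ?thesis using \<open>e > 0\<close> by (simp add: dist_norm)
    qed
    then show "\<exists>M. \<forall>z\<in>cball 0 1. \<forall>m\<ge>M. \<forall>n\<ge>M. dist (G m z) (G n z) < e" by blast
  qed
  then obtain H where H: "uniform_limit (cball 0 1) G H sequentially"
    using Cauchy_uniformly_convergent unfolding uniformly_convergent_on_def by blast
  show ?thesis
  proof (rule disk_algebraI)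
    show "continuous_on (cball 0 1) H"
      by (rule uniform_limit_theorem[OF _ H]) (use cont in auto)
    show "H holomorphic_on ball 0 1"
    proof (rule holomorphic_uniform_sequence[OF open_ball hol])
      fix x :: complex assume "x \<in> ball 0 1"
      then obtain d where "d > 0" "cball x d \<subseteq> ball 0 1"
        using open_contains_cball[of "ball (0::complex) 1"] open_ball by blast
      moreover from this have "cball x d \<subseteq> cball 0 1"
        using ball_subset_cball by blast
      then have "uniform_limit (cball x d) G H sequentially"
        by (rule uniform_limit_on_subset[OF H])
      ultimately show "\<exists>d>0. cball x d \<subseteq> ball 0 1 \<and> uniform_limit (cball x d) G H sequentially"
        by blast
    qed
    fix l :: complex assume l: "l \<in> sphere 0 1"
    have "(\<lambda>n. G n l) \<longlonglongrightarrow> H l" "(\<lambda>n. g n l) \<longlonglongrightarrow> h l"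
      using l tendsto_uniform_limitI[OF H] tendsto_uniform_limitI[OF lim] by auto
    then show "H l = h l" using eq[OF l] LIMSEQ_unique by fastforce
  qed
qed

section \<open>Differentiation of loops with respect to a parameter\<close>

lemma norm_circle_mean_le:
  assumes g: "g \<in> disk_algebra" and le: "\<And>l. l \<in> sphere 0 1 \<Longrightarrow> norm (g l) \<le> B"
  shows "norm (circle_mean g) \<le> B"
proof -
  obtain G where G: "continuous_on (cball 0 1) G" "G holomorphic_on ball 0 1"
    "\<And>l. l \<in> sphere 0 1 \<Longrightarrow> G l = g l" using disk_algebraE[OF g] by metis
  have "norm (G 0) \<le> B"
    by (rule maximum_modulus_frontier[where f = G and S = "cball 0 1"]) (use G le in auto)
  then show ?thesis using circle_mean_extension[OF G] by simp
qed

lemma linear_complex_expand: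
  fixes L :: "complex \<Rightarrow> 'b::real_vector"
  assumes "linear L"
  shows "L h = Re h *\<^sub>R L 1 + Im h *\<^sub>R L \<i>"
proof -
  have "L h = L (Re h *\<^sub>R 1 + Im h *\<^sub>R \<i>)"
    by (rule arg_cong[of _ _ L]) (simp add: complex_eq_iff)
  then show ?thesis by (simp add: linear_add[OF assms] linear_scale[OF assms])
qed

text \<open>Continuity of the derivatives is assumed for each direction separately; the directions 1
  and \<open>\<i>\<close> together control the whole real-linear map.\<close>

lemma norm_linear_complex_le:
  fixes L :: "complex \<Rightarrow> 'b::real_normed_vector"
  assumes "linear L" and "norm (L 1) \<le> B" "norm (L \<i>) \<le> B"
  shows "norm (L h) \<le> 2 * B * norm h"
proof -
  have "norm (L h) \<le> \<bar>Re h\<bar> * norm (L 1) + \<bar>Im h\<bar> * norm (L \<i>)"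
    by (subst linear_complex_expand[OF assms(1)]) (rule norm_triangle_le, simp)
  also have "\<dots> \<le> norm h * B + norm h * B"
    using abs_Re_le_cmod[of h] abs_Im_le_cmod[of h] assms
    by (intro add_mono mult_mono) auto
  finally show ?thesis by simp
qed

text \<open>\<open>C1_into_loops\<close> with the derivative named. The target is an arbitrary
  normed space, to cover the matrices \<open>F\<close> as well as the scalar entries of
  \<open>B\<close>.\<close>

locale C1_family =
  fixes f :: "complex \<Rightarrow> complex \<Rightarrow> 'b::real_normed_vector"
    and f' :: "complex \<Rightarrow> complex \<Rightarrow> complex \<Rightarrow> 'b"
  assumes deriv: "\<And>z l. l \<in> sphere 0 1 \<Longrightarrow> ((\<lambda>w. f w l) has_derivative f' z l) (at z)"
    and cont: "\<And>h. continuous_on (UNIV \<times> sphere 0 1) (\<lambda>(z, l). f' z l h)"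
begin

lemma lin: "l \<in> sphere 0 1 \<Longrightarrow> linear (f' z l)"
  by (rule has_derivative_linear[OF deriv])

text \<open>Uniform continuity on the product of a closed ball with the circle, which is compact,
  yields one radius for all loop parameters.\<close>

lemma deriv_uniformly_close:
  assumes "e > 0"
  shows "\<exists>d>0. \<forall>w l. norm (w - z) < d \<longrightarrow> l \<in> sphere 0 1 \<longrightarrow> norm (f' w l h - f' z l h) < e"
proof -
  have "uniformly_continuous_on (cball z 1 \<times> sphere 0 1) (\<lambda>(z, l). f' z l h)"
    by (intro compact_uniformly_continuous continuous_on_subset[OF cont] compact_Times) auto
  then obtain d where d: "d > 0"
    and close: "\<And>p p'. p \<in> cball z 1 \<times> sphere 0 1 \<Longrightarrow> p' \<in> cball z 1 \<times> sphere 0 1 \<Longrightarrow> dist p' p < d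
      \<Longrightarrow> dist ((\<lambda>(z, l). f' z l h) p') ((\<lambda>(z, l). f' z l h) p) < e"
    using assms unfolding uniformly_continuous_on_def by metis
  have "norm (f' w l h - f' z l h) < e" if "norm (w - z) < min d 1" "l \<in> sphere 0 1" for w l
    using close[of "(z, l)" "(w, l)"] that
    by (auto simp: dist_Pair_Pair dist_norm norm_minus_commute)
  then show ?thesis using d by (intro exI[of _ "min d 1"]) auto
qed

text \<open>The mean value inequality on a ball where the derivative varies by at most
  \<open>e\<close>; the radius of that ball does not depend on \<open>l\<close>.\<close>

lemma uniformly_differentiable:
  assumes "e > 0"
  shows "\<exists>d>0. \<forall>y l. norm y < d \<longrightarrow> l \<in> sphere 0 1 \<longrightarrow>
    norm (f (z + y) l - f z l - f' z l y) \<le> e * norm y"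
proof -
  \<comment> \<open>Each basis direction is allowed \<open>e / 2\<close>, because
    \<open>norm_linear_complex_le\<close> costs a factor 2.\<close>
  obtain d1 where d1: "d1 > 0" "\<And>w l. norm (w - z) < d1 \<Longrightarrow> l \<in> sphere 0 1 \<Longrightarrow>
      norm (f' w l 1 - f' z l 1) < e / 2"
    using deriv_uniformly_close[of "e/2" z 1] assms by auto
  obtain d2 where d2: "d2 > 0" "\<And>w l. norm (w - z) < d2 \<Longrightarrow> l \<in> sphere 0 1 \<Longrightarrow>
      norm (f' w l \<i> - f' z l \<i>) < e / 2"
    using deriv_uniformly_close[of "e/2" z \<i>] assms by auto
  define d where "d = min d1 d2"
  have "norm (f (z + y) l - f z l - f' z l y) \<le> e * norm y"
    if y: "norm y < d" and l: "l \<in> sphere 0 1" for y l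
  proof -
    have "norm (f (z + y) l - f z l - f' z l (z + y - z)) \<le> norm (z + y - z) * e"
    proof (rule differentiable_bound_linearization[where S = "ball z d" and f = "\<lambda>w. f w l"
          and f' = "\<lambda>w. f' w l"])
      show "z + t *\<^sub>R (z + y - z) \<in> ball z d" if "t \<in> {0..1}" for t
      proof -
        have "\<bar>t\<bar> * norm y \<le> 1 * norm y"
          using that by (intro mult_right_mono) auto
        then show ?thesis using y by (simp add: dist_norm)
      qed
      show "((\<lambda>w. f w l) has_derivative f' x l) (at x within ball z d)" for x
        using deriv[OF l] by (rule has_derivative_at_withinI)
      show "onorm (f' x l - f' z l) \<le> e" if x: "x \<in> ball z d" for x
      proof (rule onorm_le)
        fix h
        have "linear (\<lambda>h. f' x l h - f' z l h)"
          using lin[OF l] by (intro linear_compose_sub)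
        from norm_linear_complex_le[OF this, of "e/2" h]
        show "norm ((f' x l - f' z l) h) \<le> e * norm h"
          using d1(2)[of x l] d2(2)[of x l] x l by (simp add: d_def dist_norm norm_minus_commute)
      qed
      show "z \<in> ball z d" using d1 d2 by (simp add: d_def)
    qed
    then show ?thesis by (simp add: mult.commute)
  qed
  then show ?thesis using d1 d2 by (intro exI[of _ d]) (auto simp: d_def)
qed

text \<open>A Lipschitz estimate in \<open>z\<close>, uniform in \<open>l\<close>, is combined with
  continuity in \<open>l\<close> at the single point \<open>z\<close>.\<close>

lemma jointly_continuous:
  assumes fz: "\<And>z. continuous_on (sphere 0 1) (f z)"
  shows "continuous_on (UNIV \<times> sphere 0 1) (\<lambda>(z, l). f z l)"
  unfolding continuous_on_iff
proof (intro ballI allI impI)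
  fix p :: "complex \<times> complex" and e :: real
  assume p: "p \<in> UNIV \<times> sphere 0 1" and e: "e > 0"
  obtain z m where pz: "p = (z, m)" and m: "m \<in> sphere 0 1" using p by auto
  have bdd: "\<exists>K. \<forall>l\<in>sphere 0 1. norm (f' z l h) \<le> K" for h
  proof -
    have "continuous_on (sphere 0 1) (\<lambda>l. (\<lambda>(z, l). f' z l h) (z, l))"
      by (intro continuous_on_compose2[OF cont[of h]] continuous_intros) auto
    then have "compact ((\<lambda>l. f' z l h) ` sphere 0 1)"
      by (intro compact_continuous_image) auto
    then show ?thesis using compact_imp_bounded bounded_iff by (metis imageI)
  qed
  obtain K1 where K1: "\<forall>l\<in>sphere 0 1. norm (f' z l 1) \<le> K1"
    using bdd[of 1] ..
  obtain K2 where K2: "\<forall>l\<in>sphere 0 1. norm (f' z l \<i>) \<le> K2"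
    using bdd[of \<i>] ..
  define K where "K = max 0 (max K1 K2)"
  have K: "norm (f' z l h) \<le> 2 * K * norm h" if "l \<in> sphere 0 1" for l h
    by (rule norm_linear_complex_le[OF lin[OF that]])
      (use bspec[OF K1 that] bspec[OF K2 that] in \<open>auto simp: K_def\<close>)
  obtain d where d: "d > 0" "\<And>y l. norm y < d \<Longrightarrow> l \<in> sphere 0 1 \<Longrightarrow>
    norm (f (z + y) l - f z l - f' z l y) \<le> 1 * norm y"
    using uniformly_differentiable[of 1 z] by auto
  obtain d' where d': "d' > 0" "\<And>l. l \<in> sphere 0 1 \<Longrightarrow> dist l m < d' \<Longrightarrow> dist (f z l) (f z m) < e / 2"
    using fz[of z] m e unfolding continuous_on_iff by (meson half_gt_zero)
  \<comment> \<open>In the Lipschitz constant \<open>2 * K + 1\<close>, the first summand bounds the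
    derivative and the second is the error of linearization; \<open>r\<close> leaves
    \<open>e / 2\<close> for the variation in \<open>z\<close>.\<close>
  define r where "r = min (min d d') (e / (2 * (2 * K + 1)))"
  have K0: "2 * K + 1 > 0" by (simp add: K_def)
  have "dist (f w l) (f z m) < e" if "l \<in> sphere 0 1" "dist (w, l) (z, m) < r" for w l
  proof -
    have wl: "norm (w - z) < r" "dist l m < r"
      using that dist_fst_le[of "(w, l)" "(z, m)"] dist_snd_le[of "(w, l)" "(z, m)"]
      by (auto simp: dist_norm)
    have "norm (f w l - f z l) \<le> norm (f' z l (w - z)) + norm (w - z)"
      using d(2)[of "w - z" l] wl that norm_triangle_sub[of "f w l - f z l" "f' z l (w - z)"]
      by (simp add: r_def)
    also have "\<dots> \<le> (2 * K + 1) * norm (w - z)"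
      using K[of l "w - z"] that by (simp add: algebra_simps)
    also have "\<dots> < (2 * K + 1) * (e / (2 * (2 * K + 1)))"
      using wl K0 by (intro mult_strict_left_mono) (auto simp: r_def)
    also have "\<dots> = e / 2" using K0 by (simp add: field_simps)
    finally have "dist (f w l) (f z l) < e / 2" by (simp add: dist_norm)
    moreover have "dist (f z l) (f z m) < e / 2" using d'(2)[of l] that wl by (simp add: r_def)
    ultimately show ?thesis using dist_triangle_half_l[of "f w l" "f z l" e "f z m"] 
      by (metis dist_commute dist_triangle_half_r)
  qed
  moreover have "r > 0" using d d' e K0 by (simp add: r_def)
  ultimately show "\<exists>r>0. \<forall>q\<in>UNIV \<times> sphere 0 1. dist q p < r \<longrightarrow>
      dist (case q of (z, l) \<Rightarrow> f z l) (case p of (z, l) \<Rightarrow> f z l) < e"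
    unfolding pz by (intro exI[of _ r]) auto
qed

end

text \<open>The difference quotients lie in the disk algebra and converge uniformly on the circle by
  \<open>uniformly_differentiable\<close>.\<close>

lemma C1_family_disk_algebra:
  assumes "C1_family f f'" and f: "\<And>z. f z \<in> disk_algebra"
  shows "(\<lambda>l. f' z l h) \<in> disk_algebra"
proof -
  interpret C1_family f f' by fact
  define t where "t n = inverse (real (Suc n))" for n
  have t: "t n > 0" for n by (simp add: t_def)
  define g where "g n l = (f (z + t n *\<^sub>R h) l - f z l) * of_real (inverse (t n))" for n l
  have "uniform_limit (sphere 0 1) g (\<lambda>l. f' z l h) sequentially"
    unfolding uniform_limit_iff
  proof (intro allI impI)
    fix e :: real assume e: "e > 0"
    define e' where "e' = e / (norm h + 1)"
    have e': "e' > 0" using e by (simp add: e'_def add_nonneg_pos)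
    obtain d where d: "d > 0" "\<And>y l. norm y < d \<Longrightarrow> l \<in> sphere 0 1 \<Longrightarrow>
        norm (f (z + y) l - f z l - f' z l y) \<le> e' * norm y"
      using uniformly_differentiable[OF e', of z] by auto
    have "(\<lambda>n. norm (t n *\<^sub>R h)) \<longlonglongrightarrow> norm ((0::real) *\<^sub>R h)"
      unfolding t_def by (intro tendsto_intros LIMSEQ_inverse_real_of_nat)
    then have "\<forall>\<^sub>F n in sequentially. norm (t n *\<^sub>R h) < d"
      using d(1) by (intro order_tendstoD(2)) auto
    then show "\<forall>\<^sub>F n in sequentially. \<forall>l\<in>sphere 0 1. dist (g n l) (f' z l h) < e"
    proof eventually_elim
      case (elim n)
      show ?case
      proof
        fix l :: complex assume l: "l \<in> sphere 0 1"
        have "f' z l (t n *\<^sub>R h) = of_real (t n) * f' z l h"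
          using linear_scale[OF lin[OF l]] by (simp add: scaleR_conv_of_real)
        then have "g n l - f' z l h =
            (f (z + t n *\<^sub>R h) l - f z l - f' z l (t n *\<^sub>R h)) * of_real (inverse (t n))"
          using t[of n] by (simp add: g_def field_simps)
        then have "dist (g n l) (f' z l h) =
            norm (f (z + t n *\<^sub>R h) l - f z l - f' z l (t n *\<^sub>R h)) * inverse (t n)"
          using t[of n] by (simp add: dist_norm norm_mult norm_divide norm_inverse)
        also have "\<dots> \<le> (e' * norm (t n *\<^sub>R h)) * inverse (t n)"
          using t[of n] d(2)[OF elim l] by (intro mult_right_mono) auto
        also have "\<dots> = e' * norm h" using t[of n] by simp
        also have "\<dots> < e"
        proof -
          have "norm h + 1 > 0" by (simp add: add_nonneg_pos)
          then show ?thesis using e by (simp add: e'_def pos_divide_less_eq algebra_simps)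
        qed
        finally show "dist (g n l) (f' z l h) < e" .
      qed
    qed
  qed
  moreover have "g n \<in> disk_algebra" for n
    unfolding g_def by (intro disk_algebra_intros f)
  ultimately show ?thesis by (rule disk_algebra_uniform_limit[rotated])
qed

text \<open>Differentiation under the integral: the remainder is small uniformly on the circle, and
  \<open>norm_circle_mean_le\<close> carries this bound over to the mean.\<close>

lemma C1_family_circle_mean:
  assumes "C1_family f f'" and f: "\<And>z. f z \<in> disk_algebra"
  shows "((\<lambda>z. circle_mean (f z)) has_derivative (\<lambda>h. circle_mean (\<lambda>l. f' z l h))) (at z)"
proof -
  interpret C1_family f f' by fact
  note f' = C1_family_disk_algebra[OF assms]
  have "linear (\<lambda>h. circle_mean (\<lambda>l. f' z l h))"
  proof (rule linearI)
    fix x y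
    have "circle_mean (\<lambda>l. f' z l (x + y)) = circle_mean (\<lambda>l. f' z l x + f' z l y)"
      by (rule circle_mean_cong) (simp add: linear_add[OF lin])
    then show "circle_mean (\<lambda>l. f' z l (x + y)) =
        circle_mean (\<lambda>l. f' z l x) + circle_mean (\<lambda>l. f' z l y)"
      by (simp add: circle_mean_simps f')
  next
    fix r x
    have "f' z l (r *\<^sub>R x) = of_real r * f' z l x" if "l \<in> sphere 0 1" for l
      unfolding linear_scale[OF lin[OF that]] by (rule scaleR_conv_of_real)
    then have "circle_mean (\<lambda>l. f' z l (r *\<^sub>R x)) = circle_mean (\<lambda>l. of_real r * f' z l x)"
      by (rule circle_mean_cong)
    then show "circle_mean (\<lambda>l. f' z l (r *\<^sub>R x)) = r *\<^sub>R circle_mean (\<lambda>l. f' z l x)"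
      by (simp add: circle_mean_simps f' scaleR_conv_of_real)
  qed
  moreover have "\<exists>d>0. \<forall>y. norm (y - z) < d \<longrightarrow> norm (circle_mean (f y) - circle_mean (f z) -
      circle_mean (\<lambda>l. f' z l (y - z))) \<le> e * norm (y - z)" if e: "e > 0" for e
  proof -
    obtain d where d: "d > 0" "\<And>y l. norm y < d \<Longrightarrow> l \<in> sphere 0 1 \<Longrightarrow>
        norm (f (z + y) l - f z l - f' z l y) \<le> e * norm y"
      using uniformly_differentiable[OF e, of z] by auto
    have "norm (circle_mean (f y) - circle_mean (f z) - circle_mean (\<lambda>l. f' z l (y - z)))
        \<le> e * norm (y - z)" if y: "norm (y - z) < d" for y
    proof -
      have "norm (circle_mean (\<lambda>l. f y l - f z l - f' z l (y - z))) \<le> e * norm (y - z)"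
        by (intro norm_circle_mean_le disk_algebra_intros f f') (use d(2)[OF y] in auto)
      then show ?thesis
        by (simp add: circle_mean_simps disk_algebra_intros f f')
    qed
    then show ?thesis using d(1) by blast
  qed
  ultimately show ?thesis
    by (simp add: has_derivative_at_alt linear_conv_bounded_linear)
qed

section \<open>Laurent polynomials on the circle; uniqueness for linear systems\<close>

lemma Laurent_even:
  assumes g: "(\<lambda>l. l * g l) \<in> disk_algebra" and g': "(\<lambda>l. l * cnj (g l)) \<in> disk_algebra"
    and even: "\<And>l. l \<in> sphere 0 1 \<Longrightarrow> g (- l) = g l"
    and l: "l \<in> sphere 0 1" and m: "m \<in> sphere 0 1"
  shows "g l = g m"
proof -
  \<comment> \<open>Both products are odd, so they vanish at 0 and can be divided by
    \<open>l\<close>. Then \<open>g\<close> and its conjugate both extend, which forces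
    \<open>g\<close> to be constant.\<close>
  have "circle_mean (\<lambda>l. l * g l) = 0" "circle_mean (\<lambda>l. l * cnj (g l)) = 0"
    by (rule circle_mean_odd, use g g' even in auto)+
  from disk_algebra_divide[OF g this(1)] disk_algebra_divide[OF g' this(2)]
  have "g \<in> disk_algebra" "(\<lambda>l. cnj (g l)) \<in> disk_algebra"
    by (elim disk_algebra_cong; force)+
  then show ?thesis
    using disk_algebra_cnj_imp_const l m by metis
qed

text \<open>The two membership conditions leave only the Fourier modes -1, 0 and 1, and oddness
  removes mode 0. Since \<open>cnj l\<close> is the inverse of \<open>l\<close> on the circle, the
  remaining coefficients are values at 0 of the two products.\<close>

lemma Laurent_odd:
  assumes g: "(\<lambda>l. l * g l) \<in> disk_algebra" and g': "(\<lambda>l. l * cnj (g l)) \<in> disk_algebra"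
    and odd: "\<And>l. l \<in> sphere 0 1 \<Longrightarrow> g (- l) = - g l"
    and l: "l \<in> sphere 0 1"
  shows "g l = circle_mean (\<lambda>l. l * g l) * cnj l + cnj (circle_mean (\<lambda>l. l * cnj (g l))) * l"
proof -
  define P Q where "P = circle_mean (\<lambda>l. l * g l)" and "Q = circle_mean (\<lambda>l. l * cnj (g l))"
  \<comment> \<open>What is left after subtracting the expected Laurent polynomial. Both
    \<open>h\<close> and its conjugate extend, so \<open>h\<close> is constant, and being odd it is
    0.\<close>
  define h where "h l = g l - P * cnj l - cnj Q * l" for l
  have unit: "l * cnj l = 1" if "l \<in> sphere 0 1" for l :: complex
    using that by (simp add: complex_norm_square[symmetric])
  have 1: "(\<lambda>l. l * g l - P - cnj Q * (l * l)) \<in> disk_algebra"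
      "(\<lambda>l. l * cnj (g l) - Q - cnj P * (l * l)) \<in> disk_algebra"
    by (intro disk_algebra_intros g g')+
  have 2: "circle_mean (\<lambda>l. l * g l - P - cnj Q * (l * l)) = 0"
      "circle_mean (\<lambda>l. l * cnj (g l) - Q - cnj P * (l * l)) = 0"
    using g g' by (simp_all add: circle_mean_simps disk_algebra_intros P_def Q_def)
  have "h \<in> disk_algebra"
  proof (rule disk_algebra_cong[OF disk_algebra_divide[OF 1(1) 2(1)]])
    fix l :: complex assume l: "l \<in> sphere 0 1"
    then have "l \<noteq> 0" by auto
    moreover have "h l * l = l * g l - P * (l * cnj l) - cnj Q * (l * l)"
      by (simp add: h_def algebra_simps)
    ultimately show "h l = (l * g l - P - cnj Q * (l * l)) / l"
      by (simp add: unit[OF l] eq_divide_eq)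
  qed
  moreover have "(\<lambda>l. cnj (h l)) \<in> disk_algebra"
  proof (rule disk_algebra_cong[OF disk_algebra_divide[OF 1(2) 2(2)]])
    fix l :: complex assume l: "l \<in> sphere 0 1"
    then have "l \<noteq> 0" by auto
    moreover have "cnj (h l) * l = l * cnj (g l) - cnj P * (l * l) - Q * (l * cnj l)"
      by (simp add: h_def algebra_simps)
    ultimately show "cnj (h l) = (l * cnj (g l) - Q - cnj P * (l * l)) / l"
      by (simp add: unit[OF l] eq_divide_eq)
  qed
  ultimately have "h l = h (- l)"
    using disk_algebra_cnj_imp_const l by (metis mem_sphere_0 norm_minus_cancel)
  moreover have "h (- l) = - h l"
    using odd[OF l] by (simp add: h_def)
  ultimately have "h l = 0"
    by simp
  then show ?thesis by (simp add: h_def P_def Q_def algebra_simps)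
qed

text \<open>The Wronskian of two solutions is constant. Equal initial values give \<open>p\<close>
  and \<open>q\<close> Wronskian 0, and give \<open>p\<close> and \<open>r\<close> the Wronskian
  \<open>\<delta>\<close> of \<open>q\<close> and \<open>r\<close>. Cramer's rule in the basis
  \<open>q\<close>, \<open>r\<close> then recovers \<open>p\<close>.\<close>

lemma linear_system_unique:
  fixes p1 p2 q1 q2 r1 r2 \<beta> \<gamma> :: "complex \<Rightarrow> complex"
  assumes p: "\<And>z. (p1 has_field_derivative \<beta> z * p2 z) (at z)"
      "\<And>z. (p2 has_field_derivative \<gamma> z * p1 z) (at z)"
    and q: "\<And>z. (q1 has_field_derivative \<beta> z * q2 z) (at z)"
      "\<And>z. (q2 has_field_derivative \<gamma> z * q1 z) (at z)"
    and r: "\<And>z. (r1 has_field_derivative \<beta> z * r2 z) (at z)"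
      "\<And>z. (r2 has_field_derivative \<gamma> z * r1 z) (at z)"
    and wronskian: "\<And>z. q1 z * r2 z - q2 z * r1 z = \<delta>" and "\<delta> \<noteq> 0"
    and init: "p1 0 = q1 0" "p2 0 = q2 0"
  shows "p1 z = q1 z" "p2 z = q2 z"
proof -
  have "((\<lambda>z. p1 z * q2 z - p2 z * q1 z) has_field_derivative 0) (at z)"
    "((\<lambda>z. p1 z * r2 z - p2 z * r1 z) has_field_derivative 0) (at z)" for z
    by (rule derivative_eq_intros p q r refl | simp add: algebra_simps)+
  then obtain a b where ab: "\<And>z. p1 z * q2 z - p2 z * q1 z = a" "\<And>z. p1 z * r2 z - p2 z * r1 z = b"
    using has_field_derivative_zero_constant[OF convex_UNIV, of "\<lambda>z. p1 z * q2 z - p2 z * q1 z"]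
      has_field_derivative_zero_constant[OF convex_UNIV, of "\<lambda>z. p1 z * r2 z - p2 z * r1 z"]
    by auto
  have "a = 0" using ab(1)[of 0] init by simp
  have "b = \<delta>" using ab(2)[of 0] init wronskian[of 0] by simp
  have "p1 z * \<delta> = (p1 z * r2 z - p2 z * r1 z) * q1 z - (p1 z * q2 z - p2 z * q1 z) * r1 z"
    by (simp add: algebra_simps flip: wronskian[of z])
  then show "p1 z = q1 z" using \<open>\<delta> \<noteq> 0\<close> by (simp add: ab \<open>a = 0\<close> \<open>b = \<delta>\<close>)
  have "p2 z * \<delta> = (p1 z * r2 z - p2 z * r1 z) * q2 z - (p1 z * q2 z - p2 z * q1 z) * r2 z"
    by (simp add: algebra_simps flip: wronskian[of z])
  then show "p2 z = q2 z" using \<open>\<delta> \<noteq> 0\<close> by (simp add: ab \<open>a = 0\<close> \<open>b = \<delta>\<close>)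
qed

section \<open>Entries of special unitary matrices and of twisted loops\<close>

lemma SU2_entries:
  fixes A :: "complex^2^2"
  assumes det: "det A = 1" and unitary: "A ** conj_transpose A = mat 1"
  shows "A $ 2 $ 1 = - cnj (A $ 1 $ 2)" "A $ 2 $ 2 = cnj (A $ 1 $ 1)"
    "A $ 1 $ 1 * cnj (A $ 1 $ 1) + A $ 1 $ 2 * cnj (A $ 1 $ 2) = 1"
proof -
  have det': "A $ 1 $ 1 * A $ 2 $ 2 - A $ 1 $ 2 * A $ 2 $ 1 = 1"
    using det by (simp add: det_2)
  have "A $ 2 $ 1 * cnj (A $ 1 $ 1) + A $ 2 $ 2 * cnj (A $ 1 $ 2) = 0"
    and *: "A $ 1 $ 1 * cnj (A $ 1 $ 1) + A $ 1 $ 2 * cnj (A $ 1 $ 2) = 1"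
    using unitary
    by (auto simp: vec_eq_iff forall_2 matrix_matrix_mult_def conj_transpose_def sum_2 mat_def)
  then show "A $ 2 $ 1 = - cnj (A $ 1 $ 2)" "A $ 2 $ 2 = cnj (A $ 1 $ 1)"
    using det' by algebra+
  show "A $ 1 $ 1 * cnj (A $ 1 $ 1) + A $ 1 $ 2 * cnj (A $ 1 $ 2) = 1" by fact
qed

lemma twisted_entries:
  assumes "g \<in> loop_SL2" "l \<in> sphere 0 1"
  shows "g (- l) $ 1 $ 1 = g l $ 1 $ 1" "g (- l) $ 1 $ 2 = - g l $ 1 $ 2"
    "g (- l) $ 2 $ 1 = - g l $ 2 $ 1" "g (- l) $ 2 $ 2 = g l $ 2 $ 2"
proof -
  have "g (- l) = sigma3 ** g l ** sigma3"
    using assms by (simp add: loop_SL2_def)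
  then show "g (- l) $ 1 $ 1 = g l $ 1 $ 1" "g (- l) $ 1 $ 2 = - g l $ 1 $ 2"
    "g (- l) $ 2 $ 1 = - g l $ 2 $ 1" "g (- l) $ 2 $ 2 = g l $ 2 $ 2"
    by (simp_all add: matrix_matrix_mult_def sigma3_def sum_2)
qed

lemma loop_plus_entry:
  assumes "g \<in> loop_plus_SL2"
  shows "(\<lambda>l. g l $ i $ j) \<in> disk_algebra"
proof -
  obtain G where G: "continuous_on (cball 0 1) G"
     "\<forall>i j. (\<lambda>l. G l $ i $ j) holomorphic_on ball 0 1" "\<forall>l\<in>sphere 0 1. G l = g l"
    using assms by (auto simp: loop_plus_SL2_def)
  show ?thesis
    by (rule disk_algebraI[of "\<lambda>l. G l $ i $ j"])
      (use G in \<open>auto intro!: continuous_on_component\<close>)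
qed

section \<open>The extended frame\<close>

locale radial_frame =
  fixes k :: nat and c :: complex
    and \<Phi> F B :: "complex \<Rightarrow> complex \<Rightarrow> complex^2^2"
  assumes ode: "\<And>z l. l \<in> sphere 0 1 \<Longrightarrow>
        ((\<lambda>w. \<Phi> w l) has_derivative (\<lambda>h. \<Phi> z l ** radial_potential k c z l h)) (at z)"
    and init: "\<And>l. l \<in> sphere 0 1 \<Longrightarrow> \<Phi> 0 l = mat 1"
    and F_loop: "\<And>z. F z \<in> loop_SU2"
    and F_C1: "C1_into_loops F"
    and B_loop: "\<And>z. B z \<in> loop_plus_SL2"
    and iwasawa: "\<And>z l. l \<in> sphere 0 1 \<Longrightarrow> \<Phi> z l = F z l ** B z l"
begin

abbreviation "f z l \<equiv> F z l $ 1 $ 1"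
abbreviation "g z l \<equiv> F z l $ 1 $ 2"

lemma F_SL2: "F z \<in> loop_SL2"
  using F_loop[of z] by (simp add: loop_SU2_def)

lemma B_SL2: "B z \<in> loop_SL2"
  using B_loop[of z] by (simp add: loop_plus_SL2_def)

lemma unit: "l \<in> sphere 0 1 \<Longrightarrow> l * cnj l = (1::complex)"
  by (simp add: complex_norm_square[symmetric])

lemma F_entries:
  assumes "l \<in> sphere 0 1"
  shows "F z l $ 2 $ 1 = - cnj (g z l)" "F z l $ 2 $ 2 = cnj (f z l)"
    "f z l * cnj (f z l) + g z l * cnj (g z l) = 1"
  using SU2_entries[of "F z l"] F_loop[of z] assms by (auto simp: loop_SU2_def loop_SL2_def)

lemma det_B:
  assumes "l \<in> sphere 0 1"
  shows "B z l $ 1 $ 1 * B z l $ 2 $ 2 - B z l $ 1 $ 2 * B z l $ 2 $ 1 = 1"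
  using B_SL2[of z] assms by (simp add: loop_SL2_def det_2)

text \<open>Both Iwasawa factors have determinant 1, so no trace argument on the differential
  equation enters.\<close>

lemma det_\<Phi>:
  assumes "l \<in> sphere 0 1"
  shows "\<Phi> z l $ 1 $ 1 * \<Phi> z l $ 2 $ 2 - \<Phi> z l $ 1 $ 2 * \<Phi> z l $ 2 $ 1 = 1"
proof -
  have "det (\<Phi> z l) = 1"
    using F_SL2[of z] B_SL2[of z] assms by (simp add: iwasawa det_mul loop_SL2_def)
  then show ?thesis by (simp add: det_2)
qed

lemma B_entries:
  assumes "l \<in> sphere 0 1"
  shows "B z l $ 1 $ j = cnj (f z l) * \<Phi> z l $ 1 $ j - g z l * \<Phi> z l $ 2 $ j"
    "B z l $ 2 $ j = cnj (g z l) * \<Phi> z l $ 1 $ j + f z l * \<Phi> z l $ 2 $ j"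
proof -
  have "\<Phi> z l $ 1 $ j = f z l * B z l $ 1 $ j + g z l * B z l $ 2 $ j"
    "\<Phi> z l $ 2 $ j = - cnj (g z l) * B z l $ 1 $ j + cnj (f z l) * B z l $ 2 $ j"
    using assms by (simp_all add: iwasawa matrix_matrix_mult_def sum_2 F_entries)
  then show "B z l $ 1 $ j = cnj (f z l) * \<Phi> z l $ 1 $ j - g z l * \<Phi> z l $ 2 $ j"
    "B z l $ 2 $ j = cnj (g z l) * \<Phi> z l $ 1 $ j + f z l * \<Phi> z l $ 2 $ j"
    using F_entries(3)[OF assms, of z] by algebra+
qed

text \<open>The potential is a multiple of \<open>dz\<close>, so the entries are complex
  differentiable; on the circle \<open>inverse l\<close> becomes \<open>cnj l\<close>.\<close>

lemma \<Phi>_deriv: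
  assumes l: "l \<in> sphere 0 1"
  shows "((\<lambda>w. \<Phi> w l $ i $ 1) has_field_derivative (c * z ^ k * cnj l) * \<Phi> z l $ i $ 2) (at z)"
    "((\<lambda>w. \<Phi> w l $ i $ 2) has_field_derivative cnj l * \<Phi> z l $ i $ 1) (at z)"
proof -
  have "inverse l = cnj l" using unit[OF l] by (metis inverse_unique)
  moreover have "((\<lambda>w. \<Phi> w l $ i $ j) has_derivative
      (\<lambda>h. (\<Phi> z l ** radial_potential k c z l h) $ i $ j)) (at z)" for j
    by (intro bounded_linear.has_derivative[OF bounded_linear_vec_nth] ode l)
  from this[of 1] this[of 2] calculation
  show "((\<lambda>w. \<Phi> w l $ i $ 1) has_field_derivative (c * z ^ k * cnj l) * \<Phi> z l $ i $ 2) (at z)"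
    "((\<lambda>w. \<Phi> w l $ i $ 2) has_field_derivative cnj l * \<Phi> z l $ i $ 1) (at z)"
    by (simp_all add: has_field_derivative_def matrix_matrix_mult_def radial_potential_def sum_2 mult_ac
        mult_commute_abs)
qed

section \<open>Simultaneous rotation of \<open>z\<close> and \<open>\<lambda>\<close>, and joint
  continuity of \<open>\<Phi>\<close>\<close>

lemma \<Phi>_symmetry:
  assumes norms: "norm \<omega> = 1" "norm \<mu> = 1" "norm \<epsilon> = 1"
    and rel: "\<omega> = \<mu> * \<epsilon>" "\<omega> ^ (k + 1) * \<epsilon> = \<mu>" and l: "l \<in> sphere 0 1"
  shows "\<Phi> (\<omega> * z) (\<mu> * l) $ 1 $ 1 = \<Phi> z l $ 1 $ 1"
    "\<Phi> (\<omega> * z) (\<mu> * l) $ 1 $ 2 = \<epsilon> * \<Phi> z l $ 1 $ 2"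
    "\<Phi> (\<omega> * z) (\<mu> * l) $ 2 $ 1 = cnj \<epsilon> * \<Phi> z l $ 2 $ 1"
    "\<Phi> (\<omega> * z) (\<mu> * l) $ 2 $ 2 = \<Phi> z l $ 2 $ 2"
proof -
  have \<mu>: "\<mu> * cnj \<mu> = 1" and \<epsilon>: "\<epsilon> * cnj \<epsilon> = 1" using unit norms by auto
  have l': "\<mu> * l \<in> sphere 0 1" using l norms by (simp add: norm_mult)
  have 1: "((\<lambda>w. \<Phi> (\<omega> * w) (\<mu> * l) $ i $ 1) has_field_derivative
        (c * (\<omega> * z) ^ k * cnj (\<mu> * l)) * \<Phi> (\<omega> * z) (\<mu> * l) $ i $ 2 * \<omega>) (at z)" for i z
    by (rule DERIV_chain2[OF \<Phi>_deriv(1)[OF l']]) (auto intro!: derivative_eq_intros)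
  have 2: "((\<lambda>w. \<Phi> (\<omega> * w) (\<mu> * l) $ i $ 2) has_field_derivative
        cnj (\<mu> * l) * \<Phi> (\<omega> * z) (\<mu> * l) $ i $ 1 * \<omega>) (at z)" for i z
    by (rule DERIV_chain2[OF \<Phi>_deriv(2)[OF l']]) (auto intro!: derivative_eq_intros)
  \<comment> \<open>The relations give
    \<open>\<omega> ^ (k + 1) * cnj \<mu> = cnj \<epsilon>\<close> for the coefficient
    \<open>c * z ^ k\<close> and \<open>\<omega> * cnj \<mu> = \<epsilon>\<close> for the
    coefficient 1. So rotating the potential amounts to conjugating it by a constant diagonal
    matrix.\<close>
  have e1: "(c * (\<omega> * z) ^ k * cnj (\<mu> * l)) * x * \<omega> = (c * z ^ k * cnj l) * (cnj \<epsilon> * x)" for x z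
  proof -
    have "\<omega> ^ k * \<omega> * cnj \<mu> = \<omega> ^ (k + 1) * \<epsilon> * cnj \<epsilon> * cnj \<mu>"
      using \<epsilon> by (simp add: mult_ac)
    also have "\<dots> = cnj \<epsilon>" unfolding rel(2) using \<mu> by (simp add: mult_ac)
    finally show ?thesis by (simp add: power_mult_distrib mult_ac)
  qed
  have e2: "cnj (\<mu> * l) * x * \<omega> = cnj l * (\<epsilon> * x)" for x
  proof -
    have "cnj (\<mu> * l) * x * \<omega> = (\<mu> * cnj \<mu>) * (cnj l * (\<epsilon> * x))"
      by (simp add: rel(1) mult_ac)
    then show ?thesis by (simp add: \<mu>)
  qed
  have cancel: "cnj \<epsilon> * (cnj l * (\<epsilon> * x)) = cnj l * x" "\<epsilon> * (a * (cnj \<epsilon> * x)) = a * x" for a x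
  proof -
    have "cnj \<epsilon> * (cnj l * (\<epsilon> * x)) = (\<epsilon> * cnj \<epsilon>) * (cnj l * x)"
      "\<epsilon> * (a * (cnj \<epsilon> * x)) = (\<epsilon> * cnj \<epsilon>) * (a * x)"
      by (simp_all add: mult_ac)
    then show "cnj \<epsilon> * (cnj l * (\<epsilon> * x)) = cnj l * x" "\<epsilon> * (a * (cnj \<epsilon> * x)) = a * x"
      by (simp_all add: \<epsilon>)
  qed
  note D1 = 1[unfolded e1] and D2 = 2[unfolded e2]
  note at0 = init[OF l] init[OF l']
  \<comment> \<open>After scaling the second entry by \<open>cnj \<epsilon>\<close>, row 1 solves
    the unrotated system with initial value (1, 0). The other row of \<open>\<Phi>\<close> is the
    independent solution, with Wronskian \<open>det \<Phi> = 1\<close>.\<close>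
  have row1: "\<Phi> (\<omega> * z) (\<mu> * l) $ 1 $ 1 = \<Phi> z l $ 1 $ 1"
    "cnj \<epsilon> * \<Phi> (\<omega> * z) (\<mu> * l) $ 1 $ 2 = \<Phi> z l $ 1 $ 2"
  proof -
    have p2: "((\<lambda>w. cnj \<epsilon> * \<Phi> (\<omega> * w) (\<mu> * l) $ 1 $ 2) has_field_derivative
        cnj l * \<Phi> (\<omega> * z) (\<mu> * l) $ 1 $ 1) (at z)" for z
      using DERIV_cmult[OF D2, of "cnj \<epsilon>"] by (simp only: cancel)
    note * = linear_system_unique[OF D1 p2 \<Phi>_deriv[OF l] \<Phi>_deriv[OF l] det_\<Phi>[OF l]]
    show "\<Phi> (\<omega> * z) (\<mu> * l) $ 1 $ 1 = \<Phi> z l $ 1 $ 1"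
      by (rule *(1)) (simp_all add: at0 mat_def)
    show "cnj \<epsilon> * \<Phi> (\<omega> * z) (\<mu> * l) $ 1 $ 2 = \<Phi> z l $ 1 $ 2"
      by (rule *(2)) (simp_all add: at0 mat_def)
  qed
  \<comment> \<open>Row 2 starts at (0, 1), and its first entry is scaled instead. With the rows
    exchanged the Wronskian is -1.\<close>
  have row2: "\<epsilon> * \<Phi> (\<omega> * z) (\<mu> * l) $ 2 $ 1 = \<Phi> z l $ 2 $ 1"
    "\<Phi> (\<omega> * z) (\<mu> * l) $ 2 $ 2 = \<Phi> z l $ 2 $ 2"
  proof -
    have p1: "((\<lambda>w. \<epsilon> * \<Phi> (\<omega> * w) (\<mu> * l) $ 2 $ 1) has_field_derivative
        (c * z ^ k * cnj l) * \<Phi> (\<omega> * z) (\<mu> * l) $ 2 $ 2) (at z)" for z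
      using DERIV_cmult[OF D1, of "\<epsilon>"] by (simp only: cancel)
    have p2: "((\<lambda>w. \<Phi> (\<omega> * w) (\<mu> * l) $ 2 $ 2) has_field_derivative
        cnj l * (\<epsilon> * \<Phi> (\<omega> * z) (\<mu> * l) $ 2 $ 1)) (at z)" for z
      by (rule D2)
    have det: "\<Phi> z l $ 2 $ 1 * \<Phi> z l $ 1 $ 2 - \<Phi> z l $ 2 $ 2 * \<Phi> z l $ 1 $ 1 = - 1" for z
      using det_\<Phi>[OF l, of z] by (simp add: algebra_simps)
    note * = linear_system_unique[OF p1 p2 \<Phi>_deriv[OF l] \<Phi>_deriv[OF l] det]
    show "\<epsilon> * \<Phi> (\<omega> * z) (\<mu> * l) $ 2 $ 1 = \<Phi> z l $ 2 $ 1"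
      by (rule *(1)) (simp_all add: at0 mat_def)
    show "\<Phi> (\<omega> * z) (\<mu> * l) $ 2 $ 2 = \<Phi> z l $ 2 $ 2"
      by (rule *(2)) (simp_all add: at0 mat_def)
  qed
  show "\<Phi> (\<omega> * z) (\<mu> * l) $ 1 $ 1 = \<Phi> z l $ 1 $ 1" by (rule row1)
  show "\<Phi> (\<omega> * z) (\<mu> * l) $ 2 $ 2 = \<Phi> z l $ 2 $ 2" by (rule row2)
  show "\<Phi> (\<omega> * z) (\<mu> * l) $ 1 $ 2 = \<epsilon> * \<Phi> z l $ 1 $ 2"
    unfolding row1(2)[symmetric] mult.assoc[symmetric] \<epsilon> by simp
  show "\<Phi> (\<omega> * z) (\<mu> * l) $ 2 $ 1 = cnj \<epsilon> * \<Phi> z l $ 2 $ 1"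
    unfolding row2(1)[symmetric] mult.assoc[symmetric] mult.commute[of "cnj \<epsilon>" \<epsilon>] \<epsilon> by simp
qed

text \<open>The differential equation is given for each \<open>l\<close> separately and says nothing
  about dependence on \<open>l\<close>. The symmetry trades a change of \<open>l\<close> for a
  rotation of \<open>z\<close> at a fixed parameter \<open>l0\<close>, where continuity in
  \<open>z\<close> suffices.\<close>

lemma \<Phi>_continuous: "continuous_on (UNIV \<times> sphere 0 1) (\<lambda>(z, l). \<Phi> z l $ i $ j)"
  unfolding continuous_on_eq_continuous_within
proof
  fix p :: "complex \<times> complex" assume "p \<in> UNIV \<times> sphere 0 1"
  then obtain z0 l0 where p: "p = (z0, l0)" and l0: "l0 \<in> sphere 0 1" by auto
  then have "l0 \<noteq> 0" by auto
  \<comment> \<open>With \<open>\<mu> = m\<close> the relations of \<open>\<Phi>_symmetry\<close>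
    force \<open>\<omega> ^ (k + 2) = m\<^sup>2\<close>. So \<open>\<omega>\<close> is the power of
    \<open>m\<close> with exponent \<open>2 / (k + 2)\<close> and
    \<open>\<epsilon> = \<omega> / m\<close>, in the branch that equals 1 at
    \<open>m = 1\<close>.\<close>
  define a where "a = 2 / real (k + 2)"
  define \<omega> where "\<omega> m = exp (of_real a * Ln m)" for m :: complex
  define \<epsilon> where "\<epsilon> m = exp (of_real (a - 1) * Ln m)" for m :: complex
  define e where "e m = (if i = j then 1 else if i = 1 then \<epsilon> m else cnj (\<epsilon> m))" for m
  \<comment> \<open>This identity holds for every \<open>l\<close> on the circle, also across the
    branch cut, because only \<open>exp (Ln m) = m\<close> enters. Continuity of the branch is used
    at \<open>m = 1\<close> alone.\<close>
  have eq: "\<Phi> z l $ i $ j = e (l / l0) * \<Phi> (z / \<omega> (l / l0)) l0 $ i $ j" if l: "l \<in> sphere 0 1" for z l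
  proof -
    define m where "m = l / l0"
    have m: "norm m = 1" "m \<noteq> 0" "l = m * l0"
      using l l0 \<open>l0 \<noteq> 0\<close> by (auto simp: m_def norm_divide)
    have Re0: "Re (Ln m) = 0" using m by (simp add: Re_Ln)
    have norms: "norm (\<omega> m) = 1" "norm (\<epsilon> m) = 1"
      using Re0 by (simp_all add: \<omega>_def \<epsilon>_def norm_exp_eq_Re del: of_real_diff)
    have rel1: "\<omega> m = m * \<epsilon> m"
      using m by (simp add: \<omega>_def \<epsilon>_def exp_diff left_diff_distrib)
    have "real (k + 2) \<noteq> 0" by linarith
    then have "real (k + 2) * a = 2" unfolding a_def by (metis nonzero_eq_divide_eq mult.commute)
    then have "complex_of_real (real (k + 2) * a) = 2" by (simp only: of_real_numeral)
    then have a: "of_nat (k + 2) * (of_real a * Ln m) = Ln m + Ln m"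
      by (metis mult.assoc mult_2 of_real_mult of_real_of_nat_eq)
    have "\<omega> m ^ (k + 1) * (m * \<epsilon> m) = \<omega> m ^ (k + 2)" unfolding rel1[symmetric] by simp
    also have "\<dots> = exp (Ln m + Ln m)"
      unfolding a[symmetric] exp_of_nat_mult by (simp only: \<omega>_def)
    also have "\<dots> = m * m" unfolding exp_add using m by simp
    finally have "\<omega> m ^ (k + 1) * (m * \<epsilon> m) = m * m" .
    then have "(\<omega> m ^ (k + 1) * \<epsilon> m) * m = m * m" by (simp only: mult_ac)
    then have "\<omega> m ^ (k + 1) * \<epsilon> m = m" by (rule mult_right_cancel[OF m(2), THEN iffD1])
    note sym = \<Phi>_symmetry[OF norms(1) m(1) norms(2) rel1 this l0, of "z / \<omega> m"]
    have "\<omega> m \<noteq> 0" by (simp add: \<omega>_def)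
    then have "\<omega> m * (z / \<omega> m) = z" by simp
    then show ?thesis
      using sym exhaust_2[of i] exhaust_2[of j] unfolding m_def[symmetric] e_def by (auto simp flip: m(3))
  qed
  have Ln: "isCont Ln 1" by (rule continuous_at_Ln) auto
  have cont: "isCont \<omega> 1" "isCont \<epsilon> 1"
    unfolding \<omega>_def \<epsilon>_def by (intro isCont_exp' isCont_mult Ln continuous_const)+
  then have "isCont e 1" unfolding e_def by (cases "i = j"; cases "i = 1"; simp)
  have quot: "isCont (\<lambda>x :: complex \<times> complex. snd x / l0) p"
    using \<open>l0 \<noteq> 0\<close> by (intro continuous_at_within_divide continuous_snd continuous_ident continuous_const) auto
  have at1: "snd p / l0 = 1" using \<open>l0 \<noteq> 0\<close> by (simp add: p)
  have e: "isCont (\<lambda>x. e (snd x / l0)) p"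
    by (rule isCont_o2[OF quot]) (simp add: at1 \<open>isCont e 1\<close>)
  have \<omega>: "isCont (\<lambda>x. \<omega> (snd x / l0)) p"
    by (rule isCont_o2[OF quot]) (simp add: at1 cont)
  have arg: "isCont (\<lambda>x. fst x / \<omega> (snd x / l0)) p"
    by (intro continuous_at_within_divide continuous_fst continuous_ident \<omega>) (simp add: \<omega>_def)
  have "isCont (\<lambda>z. \<Phi> z l0) z" for z
    using ode[OF l0] by (rule has_derivative_continuous)
  then have comp: "isCont (\<lambda>z. \<Phi> z l0 $ i $ j) z" for z
    by (intro continuous_component)
  have "isCont (\<lambda>x. \<Phi> (fst x / \<omega> (snd x / l0)) l0 $ i $ j) p"
    by (rule isCont_o2[OF arg comp])
  with e have "isCont (\<lambda>x. e (snd x / l0) * \<Phi> (fst x / \<omega> (snd x / l0)) l0 $ i $ j) p"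
    by (rule isCont_mult)
  then have "continuous (at p within UNIV \<times> sphere 0 1)
      (\<lambda>x. e (snd x / l0) * \<Phi> (fst x / \<omega> (snd x / l0)) l0 $ i $ j)"
    by (rule continuous_at_imp_continuous_at_within)
  then show "continuous (at p within UNIV \<times> sphere 0 1) (\<lambda>(z, l). \<Phi> z l $ i $ j)"
  proof (rule continuous_transform_within[OF _ zero_less_one])
    show "p \<in> UNIV \<times> sphere 0 1" using p l0 by simp
    fix x :: "complex \<times> complex" assume "x \<in> UNIV \<times> sphere 0 1"
    then have "snd x \<in> sphere 0 1" by auto
    then show "e (snd x / l0) * \<Phi> (fst x / \<omega> (snd x / l0)) l0 $ i $ j = (case x of (z, l) \<Rightarrow> \<Phi> z l $ i $ j)"
      unfolding case_prod_unfold by (rule eq[symmetric])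
  qed
qed

section \<open>Derivatives of \<open>F\<close> and \<open>B\<close> with respect to the
  point\<close>

definition DF :: "complex \<Rightarrow> complex \<Rightarrow> complex \<Rightarrow> complex^2^2" where
  "DF = (SOME D. C1_family F D)"

lemma F_family: "C1_family F DF"
proof -
  obtain D where "\<forall>z. \<forall>l\<in>sphere 0 1. ((\<lambda>w. F w l) has_derivative D z l) (at z)"
      "\<forall>h. continuous_on (UNIV \<times> sphere 0 1) (\<lambda>(z, l). D z l h)"
    using F_C1 unfolding C1_into_loops_def by blast
  then have "C1_family F D"
    by (intro C1_family.intro) blast+
  then have "\<exists>D. C1_family F D" by (rule exI[of _ D])
  then show ?thesis unfolding DF_def by (rule someI_ex)
qed

lemma F_continuous: "continuous_on (UNIV \<times> sphere 0 1) (\<lambda>(z, l). F z l $ i $ j)"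
proof -
  have "continuous_on (UNIV \<times> sphere 0 1) (\<lambda>(z, l). F z l)"
    by (rule C1_family.jointly_continuous[OF F_family]) (use F_SL2 in \<open>simp add: loop_SL2_def\<close>)
  then show ?thesis
    unfolding case_prod_unfold by (intro continuous_on_component)
qed

abbreviation "df z l h \<equiv> DF z l h $ 1 $ 1"
abbreviation "dg z l h \<equiv> DF z l h $ 1 $ 2"

lemma DF_continuous: "continuous_on (UNIV \<times> sphere 0 1) (\<lambda>(z, l). DF z l h $ i $ j)"
  using C1_family.cont[OF F_family, of h]
  unfolding case_prod_unfold by (intro continuous_on_component)

lemma F_deriv:
  "l \<in> sphere 0 1 \<Longrightarrow> ((\<lambda>w. F w l $ i $ j) has_derivative (\<lambda>h. DF z l h $ i $ j)) (at z)"
  by (rule bounded_linear.has_derivative[OF bounded_linear_vec_nth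
        bounded_linear.has_derivative[OF bounded_linear_vec_nth C1_family.deriv[OF F_family]]])

lemma DF_odd:
  assumes l: "l \<in> sphere 0 1"
  shows "df z (- l) h = df z l h" "dg z (- l) h = - dg z l h"
proof -
  have l': "- l \<in> sphere 0 1" using l by simp
  have "((\<lambda>w. f w l) has_derivative (\<lambda>h. df z (- l) h)) (at z)"
    using F_deriv[OF l', of 1 1 z] by (simp add: twisted_entries[OF F_SL2 l])
  then show "df z (- l) h = df z l h"
    using has_derivative_unique[OF _ F_deriv[OF l, of 1 1 z]] by (auto dest: fun_cong)
  have "((\<lambda>w. - g w l) has_derivative (\<lambda>h. dg z (- l) h)) (at z)"
    using F_deriv[OF l', of 1 2 z] by (simp add: twisted_entries[OF F_SL2 l])
  then show "dg z (- l) h = - dg z l h"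
    using has_derivative_unique[OF _ has_derivative_minus[OF F_deriv[OF l, of 1 2 z]]]
    by (auto dest: fun_cong)
qed

text \<open>Derivative of the relation that the first row of \<open>F\<close> has length 1. It makes
  the diagonal of the Maurer-Cartan form imaginary.\<close>

lemma DF_unitary:
  assumes l: "l \<in> sphere 0 1"
  shows "cnj (f z l) * df z l h + g z l * cnj (dg z l h) =
    - (f z l * cnj (df z l h) + cnj (g z l) * dg z l h)"
proof -
  have "((\<lambda>w. f w l * cnj (f w l) + g w l * cnj (g w l)) has_derivative
      (\<lambda>h. (f z l * cnj (df z l h) + df z l h * cnj (f z l)) +
           (g z l * cnj (dg z l h) + dg z l h * cnj (g z l)))) (at z)"
    by (intro has_derivative_add has_derivative_mult has_derivative_cnj F_deriv l)
  moreover have "(\<lambda>w. f w l * cnj (f w l) + g w l * cnj (g w l)) = (\<lambda>w. 1)"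
    using F_entries(3)[OF l] by auto
  ultimately have "((\<lambda>w. 1) has_derivative
      (\<lambda>h. (f z l * cnj (df z l h) + df z l h * cnj (f z l)) +
           (g z l * cnj (dg z l h) + dg z l h * cnj (g z l)))) (at z)"
    by (simp only:)
  from fun_cong[OF has_derivative_unique[OF this has_derivative_const], of h]
  show ?thesis by algebra
qed

text \<open>Right multiplication by the off-diagonal potential moves column \<open>swap2 j\<close>
  to column \<open>j\<close>.\<close>

definition swap2 :: "2 \<Rightarrow> 2" where "swap2 j = (if j = 1 then 2 else 1)"
definition pot :: "2 \<Rightarrow> complex \<Rightarrow> complex" where "pot j z = (if j = 1 then c * z ^ k else 1)"

text \<open>
  \<open>W = (dF)\<^sup>* \<Phi>\<close> and \<open>DB = dB\<close>: the product rule for \<open>B = F\<^sup>* \<Phi>\<close> reads \<open>dB = B \<xi> + W\<close>.  The two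
  nonzero entries of \<open>\<lambda> \<xi>\<close> are \<open>pot\<close>.
\<close>

definition W :: "2 \<Rightarrow> 2 \<Rightarrow> complex \<Rightarrow> complex \<Rightarrow> complex \<Rightarrow> complex" where
  "W i j z l h = (if i = 1 then cnj (df z l h) * \<Phi> z l $ 1 $ j - dg z l h * \<Phi> z l $ 2 $ j
     else cnj (dg z l h) * \<Phi> z l $ 1 $ j + df z l h * \<Phi> z l $ 2 $ j)"

definition DB :: "2 \<Rightarrow> 2 \<Rightarrow> complex \<Rightarrow> complex \<Rightarrow> complex \<Rightarrow> complex" where
  "DB i j z l h = pot j z * (cnj l * h) * B z l $ i $ swap2 j + W i j z l h"

lemma \<Phi>_has_derivative:
  assumes "l \<in> sphere 0 1"
  shows "((\<lambda>w. \<Phi> w l $ i $ j) has_derivative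
    (\<lambda>h. pot j z * (cnj l * h) * \<Phi> z l $ i $ swap2 j)) (at z)"
proof (cases "j = 1")
  case True
  then show ?thesis
    using \<Phi>_deriv(1)[OF assms, of i z, unfolded has_field_derivative_def]
    by (auto simp: pot_def swap2_def mult_ac elim!: has_derivative_eq_rhs)
next
  case False
  then have "j = 2" using exhaust_2[of j] by auto
  then show ?thesis
    using \<Phi>_deriv(2)[OF assms, of i z, unfolded has_field_derivative_def]
    by (auto simp: pot_def swap2_def mult_ac elim!: has_derivative_eq_rhs)
qed

lemma B_continuous: "continuous_on (UNIV \<times> sphere 0 1) (\<lambda>(z, l). B z l $ i $ j)"
proof -
  have "continuous_on (UNIV \<times> sphere 0 1) (\<lambda>(z, l). if i = 1 
      then cnj (f z l) * \<Phi> z l $ 1 $ j - g z l * \<Phi> z l $ 2 $ j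
      else cnj (g z l) * \<Phi> z l $ 1 $ j + f z l * \<Phi> z l $ 2 $ j)"
    unfolding case_prod_unfold
    by (cases "i = 1"; simp only: if_True if_False refl)
      (intro continuous_on_diff continuous_on_add continuous_on_mult continuous_on_cnj
        F_continuous[unfolded case_prod_unfold] \<Phi>_continuous[unfolded case_prod_unfold])+
  then show ?thesis
    by (rule continuous_on_eq) (use exhaust_2[of i] in \<open>auto simp: B_entries\<close>)
qed

text \<open>The product rule for \<open>B\<close>, the adjoint of \<open>F\<close> times
  \<open>\<Phi>\<close>. Continuity of the derivative in both variables rests on
  \<open>\<Phi>_continuous\<close>.\<close>

lemma B_family: "C1_family (\<lambda>z l. B z l $ i $ j) (DB i j)"
proof
  fix z l :: complex assume l: "l \<in> sphere 0 1"
  show "((\<lambda>w. B w l $ i $ j) has_derivative DB i j z l) (at z)"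
  proof (cases "i = 1")
    case True
    have "((\<lambda>w. cnj (f w l) * \<Phi> w l $ 1 $ j - g w l * \<Phi> w l $ 2 $ j) has_derivative
      (\<lambda>h. (cnj (f z l) * (pot j z * (cnj l * h) * \<Phi> z l $ 1 $ swap2 j) + cnj (df z l h) * \<Phi> z l $ 1 $ j) -
           (g z l * (pot j z * (cnj l * h) * \<Phi> z l $ 2 $ swap2 j) + dg z l h * \<Phi> z l $ 2 $ j))) (at z)"
      by (intro has_derivative_diff has_derivative_mult has_derivative_cnj F_deriv \<Phi>_has_derivative l)
    then show ?thesis
      unfolding True B_entries(1)[OF l]
      by (rule has_derivative_eq_rhs) (simp add: DB_def W_def B_entries[OF l] fun_eq_iff algebra_simps)
  next
    case False
    then have i: "i = 2" using exhaust_2[of i] by auto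
    have "((\<lambda>w. cnj (g w l) * \<Phi> w l $ 1 $ j + f w l * \<Phi> w l $ 2 $ j) has_derivative
      (\<lambda>h. (cnj (g z l) * (pot j z * (cnj l * h) * \<Phi> z l $ 1 $ swap2 j) + cnj (dg z l h) * \<Phi> z l $ 1 $ j) +
           (f z l * (pot j z * (cnj l * h) * \<Phi> z l $ 2 $ swap2 j) + df z l h * \<Phi> z l $ 2 $ j))) (at z)"
      by (intro has_derivative_add has_derivative_mult has_derivative_cnj F_deriv \<Phi>_has_derivative l)
    then show ?thesis
      unfolding i B_entries(2)[OF l]
      by (rule has_derivative_eq_rhs) (simp add: DB_def W_def B_entries[OF l] fun_eq_iff algebra_simps)
  qed
next
  fix h
  show "continuous_on (UNIV \<times> sphere 0 1) (\<lambda>(z, l). DB i j z l h)"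
    unfolding case_prod_unfold DB_def W_def pot_def
    by (cases "i = 1"; cases "j = 1"; simp only: if_True if_False refl)
      (intro continuous_on_diff continuous_on_add continuous_on_mult continuous_on_cnj
        continuous_on_power continuous_on_const continuous_on_fst continuous_on_snd
        continuous_on_id DF_continuous[unfolded case_prod_unfold]
        B_continuous[unfolded case_prod_unfold] \<Phi>_continuous[unfolded case_prod_unfold])+
qed

lemma B_disk_algebra: "(\<lambda>l. B z l $ i $ j) \<in> disk_algebra"
  by (rule loop_plus_entry[OF B_loop])

lemma DB_disk_algebra: "(\<lambda>l. DB i j z l h) \<in> disk_algebra"
  by (rule C1_family_disk_algebra[OF B_family B_disk_algebra])

section \<open>The Maurer-Cartan form as a Laurent polynomial in \<open>\<lambda>\<close>\<close>

definition b :: "complex \<Rightarrow> complex" where "b z = circle_mean (\<lambda>l. B z l $ 1 $ 1)"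
definition d :: "complex \<Rightarrow> complex" where "d z = circle_mean (\<lambda>l. B z l $ 2 $ 2)"
definition Db :: "complex \<Rightarrow> complex \<Rightarrow> complex" where "Db z h = circle_mean (\<lambda>l. DB 1 1 z l h)"
definition Dd :: "complex \<Rightarrow> complex \<Rightarrow> complex" where "Dd z h = circle_mean (\<lambda>l. DB 2 2 z l h)"

lemma b_deriv: "(b has_derivative Db z) (at z)" and d_deriv: "(d has_derivative Dd z) (at z)"
  using C1_family_circle_mean[OF B_family B_disk_algebra, of 1 1 z]
    C1_family_circle_mean[OF B_family B_disk_algebra, of 2 2 z]
  by (simp_all add: b_def[abs_def] d_def[abs_def] Db_def[abs_def] Dd_def[abs_def])

lemma B_offdiag_mean: "circle_mean (\<lambda>l. B z l $ 1 $ 2) = 0" "circle_mean (\<lambda>l. B z l $ 2 $ 1) = 0"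
  by (rule circle_mean_odd[OF B_disk_algebra]; rule twisted_entries[OF B_SL2]; assumption)+

text \<open>The determinant of \<open>B\<close> evaluated at \<open>\<lambda> = 0\<close>, where the
  off-diagonal entries vanish.\<close>

lemma b_d: "b z * d z = 1"
proof -
  have "circle_mean (\<lambda>l. B z l $ 1 $ 1 * B z l $ 2 $ 2 - B z l $ 1 $ 2 * B z l $ 2 $ 1) = circle_mean (\<lambda>l. 1)"
    by (rule circle_mean_cong) (rule det_B)
  then show ?thesis
    by (simp add: circle_mean_simps disk_algebra_intros B_disk_algebra B_offdiag_mean b_def d_def)
qed

text \<open>Exhibits \<open>W\<close> as having at most a simple pole at
  \<open>\<lambda> = 0\<close>: the right-hand side extends to the disk.\<close>

lemma l_W:
  assumes "l \<in> sphere 0 1"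
  shows "l * W i j z l h = l * DB i j z l h - pot j z * h * B z l $ i $ swap2 j"
proof -
  have "l * DB i j z l h = (l * cnj l) * (pot j z * h * B z l $ i $ swap2 j) + l * W i j z l h"
    by (simp add: DB_def algebra_simps)
  then show ?thesis by (simp add: unit[OF assms])
qed

text \<open>The entries of the Maurer-Cartan form \<open>F\<^sup>-\<^sup>1 dF\<close>, written with \<open>F\<^sup>-\<^sup>1 = F\<^sup>*\<close>.\<close>

definition a11 :: "complex \<Rightarrow> complex \<Rightarrow> complex \<Rightarrow> complex" where
  "a11 z l h = cnj (f z l) * df z l h + g z l * cnj (dg z l h)"

definition a12 :: "complex \<Rightarrow> complex \<Rightarrow> complex \<Rightarrow> complex" where
  "a12 z l h = cnj (f z l) * dg z l h - g z l * cnj (df z l h)"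

lemma pot_simps: "pot 1 z = c * z ^ k" "pot 2 z = 1" "swap2 1 = 2" "swap2 2 = 1"
  by (simp_all add: pot_def swap2_def)

lemma cnj_a11:
  assumes "l \<in> sphere 0 1"
  shows "cnj (a11 z l h) = - a11 z l h"
proof -
  have "cnj (a11 z l h) = f z l * cnj (df z l h) + cnj (g z l) * dg z l h"
    unfolding a11_def by (simp only: complex_cnj_add complex_cnj_mult complex_cnj_cnj)
  also have "\<dots> = - a11 z l h"
    unfolding a11_def DF_unitary[OF assms] by (rule minus_minus[symmetric])
  finally show ?thesis .
qed

text \<open>The first row of \<open>dF = F \<alpha>\<close>, where \<open>\<alpha>\<close> is the
  Maurer-Cartan form.\<close>

lemma DF_eq:
  assumes l: "l \<in> sphere 0 1"
  shows "df z l h = f z l * a11 z l h - g z l * cnj (a12 z l h)"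
    "dg z l h = f z l * a12 z l h - g z l * a11 z l h"
proof -
  have "f z l * a11 z l h - g z l * cnj (a12 z l h) =
      df z l h * (f z l * cnj (f z l) + g z l * cnj (g z l))"
    by (simp add: a11_def a12_def algebra_simps)
  then show "df z l h = f z l * a11 z l h - g z l * cnj (a12 z l h)"
    by (simp only: F_entries(3)[OF l] mult_1_right)
  have "f z l * a12 z l h - g z l * a11 z l h =
      f z l * a12 z l h + g z l * cnj (a11 z l h)"
    by (simp add: cnj_a11[OF l])
  also have "\<dots> = dg z l h * (f z l * cnj (f z l) + g z l * cnj (g z l))"
    by (simp add: a11_def a12_def algebra_simps)
  finally show "dg z l h = f z l * a12 z l h - g z l * a11 z l h"
    by (simp only: F_entries(3)[OF l] mult_1_right)
qed

text \<open>From \<open>dF = F \<alpha>\<close> and \<open>\<Phi> = F B\<close>, the adjoint of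
  \<open>\<alpha>\<close> equals \<open>W\<close> times the inverse of \<open>B\<close>, and that
  inverse is the adjugate. Hence the poles of \<open>\<alpha>\<close> and of its adjoint at 0 are no
  worse than those of \<open>W\<close>.\<close>

lemma a_W:
  assumes l: "l \<in> sphere 0 1"
  shows "a11 z l h = W 1 2 z l h * B z l $ 2 $ 1 - W 1 1 z l h * B z l $ 2 $ 2"
    "a12 z l h = W 1 1 z l h * B z l $ 1 $ 2 - W 1 2 z l h * B z l $ 1 $ 1"
    "cnj (a12 z l h) = W 2 1 z l h * B z l $ 2 $ 2 - W 2 2 z l h * B z l $ 2 $ 1"
proof -
  let ?det = "\<Phi> z l $ 1 $ 1 * \<Phi> z l $ 2 $ 2 - \<Phi> z l $ 1 $ 2 * \<Phi> z l $ 2 $ 1"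
  have "W 1 2 z l h * B z l $ 2 $ 1 - W 1 1 z l h * B z l $ 2 $ 2 = - cnj (a11 z l h) * ?det"
    "W 1 1 z l h * B z l $ 1 $ 2 - W 1 2 z l h * B z l $ 1 $ 1 = a12 z l h * ?det"
    "W 2 1 z l h * B z l $ 2 $ 2 - W 2 2 z l h * B z l $ 2 $ 1 = cnj (a12 z l h) * ?det"
    by (simp_all add: W_def B_entries[OF l] a11_def a12_def algebra_simps)
  then show "a11 z l h = W 1 2 z l h * B z l $ 2 $ 1 - W 1 1 z l h * B z l $ 2 $ 2"
    "a12 z l h = W 1 1 z l h * B z l $ 1 $ 2 - W 1 2 z l h * B z l $ 1 $ 1"
    "cnj (a12 z l h) = W 2 1 z l h * B z l $ 2 $ 2 - W 2 2 z l h * B z l $ 2 $ 1"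
    by (simp_all only: det_\<Phi>[OF l] cnj_a11[OF l] mult_1_right minus_minus)
qed

lemma l_a11:
  "l \<in> sphere 0 1 \<Longrightarrow> l * a11 z l h =
    (l * DB 1 2 z l h - h * B z l $ 1 $ 1) * B z l $ 2 $ 1 -
    (l * DB 1 1 z l h - c * z ^ k * h * B z l $ 1 $ 2) * B z l $ 2 $ 2"
  using l_W[of l 1 2 z h] l_W[of l 1 1 z h]
  by (simp add: a_W pot_simps right_diff_distrib mult.assoc[symmetric])

lemma l_a12:
  "l \<in> sphere 0 1 \<Longrightarrow> l * a12 z l h =
    (l * DB 1 1 z l h - c * z ^ k * h * B z l $ 1 $ 2) * B z l $ 1 $ 2 -
    (l * DB 1 2 z l h - h * B z l $ 1 $ 1) * B z l $ 1 $ 1"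
  using l_W[of l 1 2 z h] l_W[of l 1 1 z h]
  by (simp add: a_W pot_simps right_diff_distrib mult.assoc[symmetric])

lemma l_cnj_a12:
  "l \<in> sphere 0 1 \<Longrightarrow> l * cnj (a12 z l h) =
    (l * DB 2 1 z l h - c * z ^ k * h * B z l $ 2 $ 2) * B z l $ 2 $ 2 -
    (l * DB 2 2 z l h - h * B z l $ 2 $ 1) * B z l $ 2 $ 1"
  using l_W[of l 2 2 z h] l_W[of l 2 1 z h]
  by (simp add: a_W(3) pot_simps right_diff_distrib mult.assoc[symmetric])

lemmas frame_intros = disk_algebra_intros B_disk_algebra DB_disk_algebra

definition a :: "complex \<Rightarrow> complex \<Rightarrow> complex" where "a z h = a11 z 1 h"

text \<open>A simple pole at most by \<open>l_a11\<close>, the same for the conjugate by skewness,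
  and even by twisting: \<open>Laurent_even\<close> applies.\<close>

lemma a11_const:
  assumes l: "l \<in> sphere 0 1"
  shows "a11 z l h = a z h"
  unfolding a_def
proof (rule Laurent_even[OF _ _ _ l])
  show *: "(\<lambda>l. l * a11 z l h) \<in> disk_algebra"
    by (rule disk_algebra_cong[OF _ l_a11]) (intro frame_intros)+
  show "(\<lambda>l. l * cnj (a11 z l h)) \<in> disk_algebra"
    by (rule disk_algebra_cong[OF disk_algebra_minus(1)[OF *]]) (simp add: cnj_a11)
  show "a11 z (- l) h = a11 z l h" if "l \<in> sphere 0 1" for l
    by (simp add: a11_def DF_odd[OF that] twisted_entries[OF F_SL2 that])
qed simp

lemma cnj_a: "cnj (a z h) = - a z h"
  by (simp add: a_def cnj_a11)

definition p :: "complex \<Rightarrow> complex" where "p z = (b z)\<^sup>2"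
definition q :: "complex \<Rightarrow> complex" where "q z = c * z ^ k * (d z)\<^sup>2"

text \<open>An instance of \<open>Laurent_odd\<close>. At \<open>\<lambda> = 0\<close> the terms
  with \<open>DB\<close> lose to the factor \<open>l\<close> and the off-diagonal entries of
  \<open>B\<close> vanish. So \<open>l_a12\<close> leaves \<open>p z * h\<close> and
  \<open>l_cnj_a12\<close> leaves \<open>- (q z * h)\<close>.\<close>

lemma a12_eq:
  assumes l: "l \<in> sphere 0 1"
  shows "a12 z l h = p z * h * cnj l - cnj (q z * h) * l"
proof -
  have 1: "(\<lambda>l. l * a12 z l h) \<in> disk_algebra"
    by (rule disk_algebra_cong[OF _ l_a12]) (intro frame_intros)+
  have 2: "(\<lambda>l. l * cnj (a12 z l h)) \<in> disk_algebra"
    by (rule disk_algebra_cong[OF _ l_cnj_a12]) (intro frame_intros)+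
  have odd: "a12 z (- l) h = - a12 z l h" if "l \<in> sphere 0 1" for l
    by (simp add: a12_def DF_odd[OF that] twisted_entries[OF F_SL2 that] algebra_simps)
  have "circle_mean (\<lambda>l. l * a12 z l h) = p z * h"
    by (rule trans[OF circle_mean_cong[OF l_a12]], assumption) (simp add: circle_mean_simps frame_intros B_offdiag_mean p_def power2_eq_square mult_ac flip: b_def)
  moreover have "circle_mean (\<lambda>l. l * cnj (a12 z l h)) = - (q z * h)"
    by (rule trans[OF circle_mean_cong[OF l_cnj_a12]], assumption) (simp add: circle_mean_simps frame_intros B_offdiag_mean q_def power2_eq_square mult_ac flip: d_def)
  ultimately show ?thesis
    using Laurent_odd[OF 1 2 odd l] by simp
qed

text \<open>The combination on the left annihilates the complex linear part in \<open>h\<close>. The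
  potential is complex linear, so it drops out of \<open>W\<close>, the pole disappears with it, and
  \<open>a_W\<close> can be evaluated at \<open>\<lambda> = 0\<close>.\<close>

lemma a_antilinear_part:
  "a z (\<i> * h) - \<i> * a z h = - (Db z (\<i> * h) - \<i> * Db z h) * d z"
proof -
  define E where "E j l = DB 1 j z l (\<i> * h) - \<i> * DB 1 j z l h" for j l
  have W_E: "W 1 j z l (\<i> * h) - \<i> * W 1 j z l h = E j l" for j l
    by (simp add: E_def DB_def algebra_simps)
  have "a z (\<i> * h) - \<i> * a z h = E 2 l * B z l $ 2 $ 1 - E 1 l * B z l $ 2 $ 2"
    if l: "l \<in> sphere 0 1" for l
    unfolding a11_const[OF l, symmetric] a_W(1)[OF l] W_E[symmetric] by (simp add: algebra_simps)
  then have "circle_mean (\<lambda>l. a z (\<i> * h) - \<i> * a z h) =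
      circle_mean (\<lambda>l. E 2 l * B z l $ 2 $ 1 - E 1 l * B z l $ 2 $ 2)"
    by (rule circle_mean_cong)
  moreover have "E j \<in> disk_algebra" for j
    unfolding E_def by (intro frame_intros)
  moreover have "circle_mean (E 1) = Db z (\<i> * h) - \<i> * Db z h"
    unfolding E_def by (simp add: circle_mean_simps frame_intros Db_def)
  ultimately show ?thesis
    by (simp add: circle_mean_simps frame_intros B_offdiag_mean algebra_simps flip: d_def)
qed

lemma Dd_eq: "Dd z h = - Db z h * (d z)\<^sup>2"
proof -
  have "((\<lambda>z. b z * d z) has_derivative (\<lambda>h. b z * Dd z h + Db z h * d z)) (at z)"
    by (intro has_derivative_mult b_deriv d_deriv)
  then have "((\<lambda>z. 1) has_derivative (\<lambda>h. b z * Dd z h + Db z h * d z)) (at z)"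
    by (simp only: b_d)
  from fun_cong[OF has_derivative_unique[OF this has_derivative_const], of h]
  have "b z * Dd z h + Db z h * d z = 0" .
  then show ?thesis using b_d[of z] by algebra
qed

section \<open>Holomorphy of \<open>p\<close> and \<open>q\<close> for the connection\<close>

definition Dp :: "complex \<Rightarrow> complex \<Rightarrow> complex" where "Dp z h = 2 * b z * Db z h"
text \<open>For \<open>k = 0\<close> the truncated exponent \<open>k - 1\<close> is harmless, since
  the factor \<open>of_nat k\<close> is 0.\<close>

definition Dq :: "complex \<Rightarrow> complex \<Rightarrow> complex" where
  "Dq z h = c * (of_nat k * z ^ (k - 1) * h) * (d z)\<^sup>2 + c * z ^ k * (2 * d z * Dd z h)"

lemma p_deriv: "(p has_derivative Dp z) (at z)"
proof -
  have "((\<lambda>z. b z * b z) has_derivative (\<lambda>h. b z * Db z h + Db z h * b z)) (at z)"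
    by (intro has_derivative_mult b_deriv)
  then show ?thesis
    by (simp add: p_def[abs_def] Dp_def[abs_def] power2_eq_square mult_ac)
qed

lemma q_deriv: "(q has_derivative Dq z) (at z)"
proof -
  have "((\<lambda>z. z ^ k) has_field_derivative of_nat k * z ^ (k - 1)) (at z)"
    by (auto intro!: derivative_eq_intros)
  then have "((\<lambda>z. z ^ k) has_derivative (*) (of_nat k * z ^ (k - 1))) (at z)"
    by (simp add: has_field_derivative_def)
  then have "((\<lambda>z. c * z ^ k * (d z * d z)) has_derivative
      (\<lambda>h. c * z ^ k * (d z * Dd z h + Dd z h * d z) + c * (of_nat k * z ^ (k - 1) * h) * (d z * d z))) (at z)"
    by (intro has_derivative_mult has_derivative_mult_right d_deriv)
  then show ?thesis
    unfolding q_def[abs_def] power2_eq_square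
    by (rule has_derivative_eq_rhs) (simp add: Dq_def fun_eq_iff power2_eq_square algebra_simps)
qed

text \<open>
  The covariant derivatives of \<open>p\<close> and \<open>q\<close> are complex linear, that is, \<open>p\<close> and \<open>q\<close> are
  holomorphic for the connection \<open>a\<close>.  This is what makes the surface minimal.
\<close>

lemma covariant_p: "Dp z (\<i> * h) + 2 * a z (\<i> * h) * p z = \<i> * (Dp z h + 2 * a z h * p z)"
proof -
  have "a z (\<i> * h) = \<i> * a z h - (Db z (\<i> * h) - \<i> * Db z h) * d z"
    using a_antilinear_part[of z h] by (simp add: algebra_simps)
  then show ?thesis using b_d[of z] unfolding Dp_def p_def by algebra
qed

lemma covariant_q: "Dq z (\<i> * h) - 2 * a z (\<i> * h) * q z = \<i> * (Dq z h - 2 * a z h * q z)"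
proof -
  have *: "a z (\<i> * h) = \<i> * a z h - (Db z (\<i> * h) - \<i> * Db z h) * d z"
    using a_antilinear_part[of z h] by (simp add: algebra_simps)
  show ?thesis unfolding Dq_def q_def Dd_eq * by (simp add: algebra_simps power2_eq_square)
qed

section \<open>Symmetry of the frame and radial dependence of \<open>b\<close>\<close>

lemma frame_symmetry:
  assumes norms: "norm \<omega> = 1" "norm \<mu> = 1" "norm \<epsilon> = 1"
    and rel: "\<omega> = \<mu> * \<epsilon>" "\<omega> ^ (k + 1) * \<epsilon> = \<mu>"
  obtains \<kappa> where "\<kappa> * cnj \<kappa> = 1"
    "\<And>l. l \<in> sphere 0 1 \<Longrightarrow> f (\<omega> * z) (\<mu> * l) = f z l * \<kappa>"
    "\<And>l. l \<in> sphere 0 1 \<Longrightarrow> g (\<omega> * z) (\<mu> * l) = \<epsilon> * g z l * cnj \<kappa>"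
    "\<And>l. l \<in> sphere 0 1 \<Longrightarrow> B (\<omega> * z) (\<mu> * l) $ 1 $ 1 = cnj \<kappa> * B z l $ 1 $ 1"
proof -
  define f1 g1 where "f1 l = f (\<omega> * z) (\<mu> * l)" and "g1 l = g (\<omega> * z) (\<mu> * l)" for l
  define B1 where "B1 l = B (\<omega> * z) (\<mu> * l)" for l
  have \<epsilon>: "\<epsilon> * cnj \<epsilon> = 1" using unit norms by auto
  have l1: "\<mu> * l \<in> sphere 0 1" if "l \<in> sphere 0 1" for l using that norms by (simp add: norm_mult)
  have B1: "(\<lambda>l. B1 l $ i $ j) \<in> disk_algebra" for i j
    unfolding B1_def using disk_algebra_rotate(1)[OF B_disk_algebra norms(2)] .
  \<comment> \<open>With \<open>D = diag(\<epsilon>, 1)\<close> and \<open>F1\<close> the rotated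
    frame, \<open>N11\<close> and \<open>N12 / \<epsilon>\<close> form the first row of
    \<open>F\<^sup>-\<^sup>1 D\<^sup>-\<^sup>1 F1 D\<close>. This matrix is unitary, and by
    \<open>\<Phi>_symmetry\<close> it equals
    \<open>B D\<^sup>-\<^sup>1 B1\<^sup>-\<^sup>1 D\<close>.\<close>
  define N11 where "N11 l = cnj (f z l) * f1 l + \<epsilon> * g z l * cnj (g1 l)" for l
  define N12 where "N12 l = cnj (f z l) * g1 l - \<epsilon> * g z l * cnj (f1 l)" for l
  have B1_entries: "B1 l $ 1 $ 1 = cnj (f1 l) * \<Phi> z l $ 1 $ 1 - g1 l * (cnj \<epsilon> * \<Phi> z l $ 2 $ 1)"
    "B1 l $ 1 $ 2 = cnj (f1 l) * (\<epsilon> * \<Phi> z l $ 1 $ 2) - g1 l * \<Phi> z l $ 2 $ 2"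
    "B1 l $ 2 $ 1 = cnj (g1 l) * \<Phi> z l $ 1 $ 1 + f1 l * (cnj \<epsilon> * \<Phi> z l $ 2 $ 1)"
    "B1 l $ 2 $ 2 = cnj (g1 l) * (\<epsilon> * \<Phi> z l $ 1 $ 2) + f1 l * \<Phi> z l $ 2 $ 2"
    if l: "l \<in> sphere 0 1" for l
    unfolding B1_def B_entries[OF l1[OF l]] \<Phi>_symmetry[OF norms rel l] f1_def g1_def by simp_all
  \<comment> \<open>The second description of that matrix: polynomials in the entries of
    \<open>B\<close> and \<open>B1\<close>, for the row and for its conjugate. So both extend to the
    disk and the row is constant.\<close>
  have N: "N11 l = B z l $ 1 $ 1 * B1 l $ 2 $ 2 - \<epsilon> * B z l $ 1 $ 2 * B1 l $ 2 $ 1"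
    "cnj (N11 l) = B z l $ 2 $ 2 * B1 l $ 1 $ 1 - cnj \<epsilon> * B z l $ 2 $ 1 * B1 l $ 1 $ 2"
    "N12 l = \<epsilon> * B z l $ 1 $ 2 * B1 l $ 1 $ 1 - B z l $ 1 $ 1 * B1 l $ 1 $ 2"
    "cnj (N12 l) = B z l $ 2 $ 2 * B1 l $ 2 $ 1 - cnj \<epsilon> * B z l $ 2 $ 1 * B1 l $ 2 $ 2"
    if l: "l \<in> sphere 0 1" for l
    unfolding B1_entries[OF l] B_entries[OF l] N11_def N12_def complex_cnj_add complex_cnj_diff
      complex_cnj_mult complex_cnj_cnj
    using det_\<Phi>[OF l, of z] \<epsilon> by algebra+
  have N11: "N11 l = circle_mean N11" if "l \<in> sphere 0 1" for l
  proof (rule disk_algebra_cnj_imp_const[OF _ _ that])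
    show "N11 \<in> disk_algebra"
      by (rule disk_algebra_cong[OF _ N(1)]) (intro frame_intros B1)+
    show "(\<lambda>l. cnj (N11 l)) \<in> disk_algebra"
      by (rule disk_algebra_cong[OF _ N(2)]) (intro frame_intros B1)+
  qed
  have N12: "N12 l = 0" if "l \<in> sphere 0 1" for l
  proof -
    have in_A: "N12 \<in> disk_algebra"
      by (rule disk_algebra_cong[OF _ N(3)]) (intro frame_intros B1)+
    moreover have "(\<lambda>l. cnj (N12 l)) \<in> disk_algebra"
      by (rule disk_algebra_cong[OF _ N(4)]) (intro frame_intros B1)+
    \<comment> \<open>The constant \<open>N12\<close> is odd in \<open>l\<close> by the twisting
      condition.\<close>
    moreover have "circle_mean N12 = 0"
    proof (rule circle_mean_odd[OF in_A])
      fix l :: complex assume l: "l \<in> sphere 0 1"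
      have "f1 (- l) = f1 l" "g1 (- l) = - g1 l"
        using twisted_entries[OF F_SL2 l1[OF l]] by (simp_all add: f1_def g1_def)
      then show "N12 (- l) = - N12 l"
        by (simp add: N12_def twisted_entries[OF F_SL2 l])
    qed
    ultimately show ?thesis using disk_algebra_cnj_imp_const[OF _ _ that] by metis
  qed
  define \<kappa> where "\<kappa> = circle_mean N11"
  \<comment> \<open>Solves back for the rotated frame:
    \<open>F1 = D F diag(\<kappa>, cnj \<kappa>) D\<^sup>-\<^sup>1\<close>, first row.\<close>
  have f1: "f1 l = f z l * \<kappa>" and g1: "g1 l = \<epsilon> * g z l * cnj \<kappa>" if l: "l \<in> sphere 0 1" for l
  proof -
    have "f z l * N11 l - \<epsilon> * g z l * cnj (N12 l) = f1 l"
      "f z l * N12 l + \<epsilon> * g z l * cnj (N11 l) = g1 l"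
      unfolding N11_def N12_def complex_cnj_add complex_cnj_diff complex_cnj_mult complex_cnj_cnj
      using F_entries(3)[OF l, of z] \<epsilon> by algebra+
    then show "f1 l = f z l * \<kappa>" "g1 l = \<epsilon> * g z l * cnj \<kappa>"
      using N11[OF l] by (simp_all add: N12[OF l] \<kappa>_def)
  qed
  show thesis
  proof
    have 1: "1 \<in> sphere (0::complex) 1" by simp
    have "f1 1 * cnj (f1 1) + g1 1 * cnj (g1 1) = 1"
      unfolding f1_def g1_def by (rule F_entries(3)[OF l1[OF 1]])
    then show "\<kappa> * cnj \<kappa> = 1"
      unfolding f1[OF 1] g1[OF 1] complex_cnj_mult complex_cnj_cnj
      using F_entries(3)[OF 1, of z] \<epsilon> by algebra
    fix l :: complex assume l: "l \<in> sphere 0 1"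
    show "f (\<omega> * z) (\<mu> * l) = f z l * \<kappa>" "g (\<omega> * z) (\<mu> * l) = \<epsilon> * g z l * cnj \<kappa>"
      using f1[OF l] g1[OF l] by (simp_all add: f1_def g1_def)
    have "B1 l $ 1 $ 1 = cnj \<kappa> * B z l $ 1 $ 1"
      unfolding B1_entries[OF l] B_entries[OF l] f1[OF l] g1[OF l] complex_cnj_mult complex_cnj_cnj
      using \<epsilon> by algebra
    then show "B (\<omega> * z) (\<mu> * l) $ 1 $ 1 = cnj \<kappa> * B z l $ 1 $ 1"
      by (simp add: B1_def)
  qed
qed

lemma norm_b_radial:
  assumes "norm z = norm w"
  shows "norm (b z) = norm (b w)"
proof (cases "w = 0")
  case True
  then show ?thesis using assms by simp
next
  case False
  define \<omega> where "\<omega> = z / w"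
  have \<omega>: "norm \<omega> = 1" "z = \<omega> * w" using False assms by (auto simp: \<omega>_def norm_divide)
  \<comment> \<open>Given \<open>\<omega> = z / w\<close>, the relations amount to
    \<open>\<mu>\<^sup>2 = \<omega> ^ (k + 2)\<close> and
    \<open>\<epsilon> = \<omega> / \<mu>\<close>.\<close>
  define \<mu> where "\<mu> = csqrt (\<omega> ^ (k + 2))"
  have \<mu>2: "\<mu> * \<mu> = \<omega> ^ (k + 2)"
    unfolding \<mu>_def by (metis power2_csqrt power2_eq_square)
  have "norm \<mu> * norm \<mu> = 1" using arg_cong[OF \<mu>2, of norm] \<omega> by (simp add: norm_mult norm_power)
  then have \<mu>: "norm \<mu> = 1" by (metis norm_ge_zero abs_of_nonneg power2_eq_1_iff power2_eq_square abs_1 abs_minus_cancel)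
  then have "\<mu> \<noteq> 0" by auto
  define \<epsilon> where "\<epsilon> = \<omega> / \<mu>"
  have \<epsilon>: "norm \<epsilon> = 1" using \<omega> \<mu> by (simp add: \<epsilon>_def norm_divide)
  have rel: "\<omega> = \<mu> * \<epsilon>" using \<open>\<mu> \<noteq> 0\<close> by (simp add: \<epsilon>_def)
  have rel2: "\<omega> ^ (k + 1) * \<epsilon> = \<mu>"
    using \<mu>2 \<open>\<mu> \<noteq> 0\<close> by (simp add: \<epsilon>_def divide_eq_eq mult_ac)
  obtain \<kappa> where \<kappa>: "\<kappa> * cnj \<kappa> = 1"
    "\<And>l. l \<in> sphere 0 1 \<Longrightarrow> B (\<omega> * w) (\<mu> * l) $ 1 $ 1 = cnj \<kappa> * B w l $ 1 $ 1"
    by (rule frame_symmetry[OF \<omega>(1) \<mu> \<epsilon> rel rel2, of w]) blast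
  \<comment> \<open>Rotating the loop parameter by \<open>\<mu>\<close> fixes the value at
    \<open>\<lambda> = 0\<close>, so only the unit factor \<open>cnj \<kappa>\<close> separates
    \<open>b z\<close> from \<open>b w\<close>.\<close>
  have "b z = circle_mean (\<lambda>l. B (\<omega> * w) (\<mu> * l) $ 1 $ 1)"
    unfolding b_def \<omega>(2) by (rule disk_algebra_rotate(2)[OF B_disk_algebra \<mu>, symmetric])
  also have "\<dots> = circle_mean (\<lambda>l. cnj \<kappa> * B w l $ 1 $ 1)"
    by (rule circle_mean_cong) (rule \<kappa>(2))
  also have "\<dots> = cnj \<kappa> * b w"
    by (simp add: circle_mean_simps frame_intros b_def)
  finally have "norm (b z) = norm \<kappa> * norm (b w)" by (simp add: norm_mult)
  moreover have "norm \<kappa> = 1"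
    using \<kappa>(1) by (metis complex_mod_cnj norm_one norm_mult norm_ge_zero abs_of_nonneg power2_eq_1_iff power2_eq_square abs_1 abs_minus_cancel)
  ultimately show ?thesis by simp
qed

end

section \<open>The surface in Segre coordinates\<close>

lemma vector_4:
  "(vector [w, x, y, z] :: 'a::zero^4) $ 1 = w" "(vector [w, x, y, z] :: 'a^4) $ 2 = x"
  "(vector [w, x, y, z] :: 'a^4) $ 3 = y" "(vector [w, x, y, z] :: 'a^4) $ 4 = z"
  unfolding vector_def by simp_all

definition herm2 :: "complex^2 \<Rightarrow> complex^2 \<Rightarrow> complex" where
  "herm2 x y = x $ 1 * cnj (y $ 1) + x $ 2 * cnj (y $ 2)"

definition det2 :: "complex^2 \<Rightarrow> complex^2 \<Rightarrow> complex" where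
  "det2 x y = x $ 1 * y $ 2 - x $ 2 * y $ 1"

text \<open>
  The Segre embedding, composed with the unitary map that takes the image of the
  projectivized decomposable tensors to the quadric.
\<close>

definition segre :: "complex^2 \<Rightarrow> complex^2 \<Rightarrow> complex^4" where
  "segre x y = complex_of_real (1 / sqrt 2) *s vector
     [x $ 2 * y $ 1 - x $ 1 * y $ 2, \<i> * (x $ 1 * y $ 2 + x $ 2 * y $ 1),
      x $ 1 * y $ 1 + x $ 2 * y $ 2, - \<i> * (x $ 1 * y $ 1 - x $ 2 * y $ 2)]"

definition isqrt2 :: complex where "isqrt2 = complex_of_real (1 / sqrt 2)"

lemma isqrt2: "2 * (isqrt2 * isqrt2) = 1" "cnj isqrt2 = isqrt2"
  by (simp_all add: isqrt2_def flip: of_real_mult)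

lemma segre_nth: "segre x y $ 1 = isqrt2 * (x $ 2 * y $ 1 - x $ 1 * y $ 2)"
    "segre x y $ 2 = isqrt2 * (\<i> * (x $ 1 * y $ 2 + x $ 2 * y $ 1))"
    "segre x y $ 3 = isqrt2 * (x $ 1 * y $ 1 + x $ 2 * y $ 2)"
    "segre x y $ 4 = isqrt2 * (- \<i> * (x $ 1 * y $ 1 - x $ 2 * y $ 2))"
  by (simp_all only: segre_def vector_smult_component vector_4 isqrt2_def)

lemma herm_segre: "herm (segre x y) (segre x' y') = herm2 x x' * herm2 y y'"
proof -
  have "herm (segre x y) (segre x' y') = (2 * (isqrt2 * isqrt2)) * (herm2 x x' * herm2 y y')"
    by (simp add: herm_def sum_4 herm2_def segre_nth isqrt2(2) algebra_simps)
  then show ?thesis by (simp only: isqrt2 mult_1_left)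
qed

text \<open>The quadratic form of the quadric becomes the product of two area forms, so every
  decomposable tensor is isotropic.\<close>

lemma sum_segre_mult: "(\<Sum>i\<in>UNIV. segre x y $ i * segre x' y' $ i) = det2 x x' * det2 y y'"
proof -
  have "(\<Sum>i\<in>UNIV. segre x y $ i * segre x' y' $ i) = (2 * (isqrt2 * isqrt2)) * (det2 x x' * det2 y y')"
    by (simp add: sum_4 det2_def segre_nth algebra_simps)
  then show ?thesis by (simp only: isqrt2 mult_1_left)
qed

text \<open>The quaternionic structure of the plane: antilinear with square -1. Applied to both
  tensor factors it becomes complex conjugation in the coordinates of \<open>segre\<close>.\<close>

definition quat_J :: "complex^2 \<Rightarrow> complex^2" where
  "quat_J x = vector [- cnj (x $ 2), cnj (x $ 1)]"

lemma segre_quat_J: "segre (quat_J x) (quat_J y) $ i = cnj (segre x y $ i)"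
  using exhaust_4[of i]
  by (auto simp: segre_nth quat_J_def isqrt2(2) algebra_simps)

lemma segre_linear:
  "segre (x + x') y = segre x y + segre x' y" "segre x (y + y') = segre x y + segre x y'"
  "segre (s *s x) y = s *s segre x y" "segre x (s *s y) = s *s segre x y"
  by (simp_all add: vec_eq_iff forall_4 segre_nth algebra_simps)

lemma scaleR_eq_vector_scalar_mult: "r *\<^sub>R (x :: complex^'n) = of_real r *s x"
  by (simp add: vec_eq_iff) (simp add: scaleR_conv_of_real)

lemma bounded_bilinear_segre: "bounded_bilinear segre"
  unfolding bilinear_conv_bounded_bilinear[symmetric]
  by (auto simp: bilinear_def linear_iff segre_linear scaleR_eq_vector_scalar_mult)

lemma bounded_bilinear_vector_scalar_mult:
  "bounded_bilinear ((*s) :: complex \<Rightarrow> complex^'n \<Rightarrow> complex^'n)"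
  unfolding bilinear_conv_bounded_bilinear[symmetric]
  by (auto simp: bilinear_def linear_iff vec_eq_iff algebra_simps)

lemma bounded_linear_column: "bounded_linear (column j :: complex^2^2 \<Rightarrow> complex^2)"
  by (intro linear_conv_bounded_linear[THEN iffD1] linearI) (simp_all add: column_def vec_eq_iff)

lemma herm_scaleC_left: "herm (s *s v) w = s * herm v w"
  and herm_scaleC_right: "herm v (s *s w) = cnj s * herm v w"
  and herm_add_left: "herm (v + v') w = herm v w + herm v' w"
  and herm_add_right: "herm v (w + w') = herm v w + herm v w'"
  and herm_commute: "herm v w = cnj (herm w v)"
  by (simp_all add: herm_def sum_4 algebra_simps)

lemma herm_self: "herm v v = of_real ((norm v)\<^sup>2)"
proof -
  have "norm v = sqrt (\<Sum>i\<in>UNIV. (norm (v $ i))\<^sup>2)"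
    by (simp add: norm_vec_def L2_set_def)
  then have "(norm v)\<^sup>2 = (\<Sum>i\<in>UNIV. (norm (v $ i))\<^sup>2)"
    by (simp add: sum_nonneg)
  then show ?thesis
    by (simp only: herm_def of_real_sum complex_norm_square)
qed

section \<open>The tensor frame along the surface and the derivatives of the lift\<close>

context radial_frame
begin

definition e :: "2 \<Rightarrow> complex \<Rightarrow> complex \<Rightarrow> complex^2" where "e j z l = column j (F z l)"

lemma e_nth:
  assumes "l \<in> sphere 0 1"
  shows "e 1 z l $ 1 = f z l" "e 1 z l $ 2 = - cnj (g z l)"
    "e 2 z l $ 1 = g z l" "e 2 z l $ 2 = cnj (f z l)"
  by (simp_all add: e_def column_def F_entries[OF assms])

lemma e_unitary:
  assumes l: "l \<in> sphere 0 1"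
  shows "herm2 (e 1 z l) (e 1 z l) = 1" "herm2 (e 2 z l) (e 2 z l) = 1"
    "herm2 (e 1 z l) (e 2 z l) = 0" "herm2 (e 2 z l) (e 1 z l) = 0"
    "det2 (e 1 z l) (e 2 z l) = 1"
  using F_entries(3)[OF l, of z] by (simp_all add: herm2_def det2_def e_nth[OF l] algebra_simps)

lemma quat_J_e:
  assumes l: "l \<in> sphere 0 1"
  shows "quat_J (e 2 z l) = - 1 *s e 1 z l" "quat_J (e 1 z l) = e 2 z l"
  by (simp_all add: vec_eq_iff forall_2 quat_J_def e_nth[OF l])

lemma DF_entries:
  assumes l: "l \<in> sphere 0 1"
  shows "DF z l h $ 2 $ 1 = - cnj (dg z l h)" "DF z l h $ 2 $ 2 = cnj (df z l h)"
proof -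
  have "((\<lambda>w. - cnj (g w l)) has_derivative (\<lambda>h. - cnj (dg z l h))) (at z)"
    "((\<lambda>w. cnj (f w l)) has_derivative (\<lambda>h. cnj (df z l h))) (at z)"
    by (intro has_derivative_minus has_derivative_cnj F_deriv l)+
  moreover have "((\<lambda>w. - cnj (g w l)) has_derivative (\<lambda>h. DF z l h $ 2 $ 1)) (at z)"
    "((\<lambda>w. cnj (f w l)) has_derivative (\<lambda>h. DF z l h $ 2 $ 2)) (at z)"
    using F_deriv[OF l, of 2 1 z] F_deriv[OF l, of 2 2 z] by (simp_all add: F_entries[OF l])
  ultimately have "(\<lambda>h. DF z l h $ 2 $ 1) = (\<lambda>h. - cnj (dg z l h))"
    "(\<lambda>h. DF z l h $ 2 $ 2) = (\<lambda>h. cnj (df z l h))"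
    by (auto intro: has_derivative_unique)
  then show "DF z l h $ 2 $ 1 = - cnj (dg z l h)" "DF z l h $ 2 $ 2 = cnj (df z l h)"
    by (auto dest: fun_cong)
qed

text \<open>The two columns of \<open>dF = F \<alpha>\<close>.\<close>

lemma e_deriv:
  assumes l: "l \<in> sphere 0 1"
  shows "((\<lambda>w. e 1 w l) has_derivative
      (\<lambda>h. a z h *s e 1 z l + (- cnj (a12 z l h)) *s e 2 z l)) (at z)"
    "((\<lambda>w. e 2 w l) has_derivative (\<lambda>h. a12 z l h *s e 1 z l + (- a z h) *s e 2 z l)) (at z)"
proof -
  have D: "((\<lambda>w. e j w l) has_derivative (\<lambda>h. column j (DF z l h))) (at z)" for j
    unfolding e_def
    by (rule bounded_linear.has_derivative[OF bounded_linear_column C1_family.deriv[OF F_family l]])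
  have "column 1 (DF z l h) = a z h *s e 1 z l + (- cnj (a12 z l h)) *s e 2 z l"
    "column 2 (DF z l h) = a12 z l h *s e 1 z l + (- a z h) *s e 2 z l" for h
    by (simp_all add: vec_eq_iff forall_2 column_def DF_entries[OF l] e_nth[OF l] DF_eq[OF l]
      a11_const[OF l] cnj_a)
  then show "((\<lambda>w. e 1 w l) has_derivative
      (\<lambda>h. a z h *s e 1 z l + (- cnj (a12 z l h)) *s e 2 z l)) (at z)"
    "((\<lambda>w. e 2 w l) has_derivative (\<lambda>h. a12 z l h *s e 1 z l + (- a z h) *s e 2 z l)) (at z)"
    using D[of 1] D[of 2] by simp_all
qed

lemma matrix_inv_F:
  assumes "l \<in> sphere 0 1"
  shows "matrix_inv (F z l) = conj_transpose (F z l)"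
proof -
  have "F z l ** conj_transpose (F z l) = mat 1"
    using F_loop[of z] assms by (simp add: loop_SU2_def)
  then have inv: "F z l ** conj_transpose (F z l) = mat 1" "conj_transpose (F z l) ** F z l = mat 1"
    using matrix_left_right_inverse by blast+
  show ?thesis
    unfolding matrix_inv_def
  proof (rule some_equality)
    fix M assume "F z l ** M = mat 1 \<and> M ** F z l = mat 1"
    then have "M ** (F z l ** conj_transpose (F z l)) = conj_transpose (F z l)"
      by (simp add: matrix_mul_assoc)
    then show "M = conj_transpose (F z l)" by (simp add: inv)
  qed (use inv in simp)
qed

text \<open>An orthonormal frame adapted to the surface: \<open>fr 2 1\<close> is the lift,
  \<open>fr 1 1\<close> and \<open>fr 2 2\<close> span the tangent space of the quadric, and
  \<open>fr 1 2\<close> is minus the conjugate of the lift, hence normal to the quadric.\<close>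

definition fr :: "2 \<Rightarrow> 2 \<Rightarrow> complex \<Rightarrow> complex \<Rightarrow> complex^4" where
  "fr i j l z = segre (e i z l) (e j z (- \<i> * l))"

text \<open>Corresponding entries of \<open>surf_X\<close> and \<open>surf_Y\<close> are, up to the
  factor \<open>\<i>\<close> or its negative, sum and difference of the same two products. Pairing
  their real and imaginary parts recovers the tensor coordinates.\<close>

lemma f_hat_eq_segre:
  assumes l: "l \<in> sphere 0 1"
  shows "f_hat F l z = fr 2 1 l z"
proof -
  have l': "- \<i> * l \<in> sphere 0 1" using l by (simp add: norm_mult)
  have X: "surf_X F l z $ 1 $ 1 = f z l * cnj (f z (- \<i> * l)) + g z l * cnj (g z (- \<i> * l))"
    "surf_X F l z $ 1 $ 2 = g z l * f z (- \<i> * l) - f z l * g z (- \<i> * l)"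
    "surf_Y F l z $ 1 $ 1 = \<i> * (f z l * cnj (f z (- \<i> * l)) - g z l * cnj (g z (- \<i> * l)))"
    "surf_Y F l z $ 1 $ 2 = - \<i> * (g z l * f z (- \<i> * l) + f z l * g z (- \<i> * l))"
    unfolding surf_X_def surf_Y_def matrix_inv_F[OF l']
    by (simp_all add: matrix_matrix_mult_def sum_2 conj_transpose_def sigma3_def mat_def
      F_entries[OF l, simplified] F_entries[OF l', simplified] algebra_simps)
  show ?thesis
    unfolding f_hat_def fr_def segre_def X e_nth[OF l] e_nth[OF l']
    by (rule arg_cong[of _ _ "(*s) _"]) (simp add: vec_eq_iff forall_4 vector_4 complex_eq_iff algebra_simps)
qed

lemma herm_fr:
  assumes l: "l \<in> sphere 0 1"
  shows "herm (fr i j l z) (fr i' j' l z) = (if i = i' \<and> j = j' then 1 else 0)"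
proof -
  have "- \<i> * l \<in> sphere 0 1" using l by (simp add: norm_mult)
  from e_unitary[OF l, of z] e_unitary[OF this, of z] show ?thesis
    using exhaust_2[of i] exhaust_2[of j] exhaust_2[of i'] exhaust_2[of j']
    by (auto simp: fr_def herm_segre)
qed

text \<open>\<open>u12\<close> and \<open>u21\<close> are the components of the derivative of the
  lift along \<open>fr 1 1\<close> and \<open>fr 2 2\<close>: \<open>a12\<close> at
  \<open>l\<close>, and minus the conjugate of \<open>a12\<close> at \<open>- \<i> * l\<close>,
  written in \<open>p\<close> and \<open>q\<close>.\<close>

definition u12 :: "complex \<Rightarrow> complex \<Rightarrow> complex \<Rightarrow> complex" where
  "u12 l z h = p z * h * cnj l - cnj (q z * h) * l"

definition u21 :: "complex \<Rightarrow> complex \<Rightarrow> complex \<Rightarrow> complex" where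
  "u21 l z h = \<i> * (l * cnj (p z * h) + cnj l * (q z * h))"

definition Du12 :: "complex \<Rightarrow> complex \<Rightarrow> complex \<Rightarrow> complex \<Rightarrow> complex" where
  "Du12 l z w v = Dp z v * w * cnj l - cnj (Dq z v * w) * l"

definition Du21 :: "complex \<Rightarrow> complex \<Rightarrow> complex \<Rightarrow> complex \<Rightarrow> complex" where
  "Du21 l z w v = \<i> * (l * cnj (Dp z v * w) + cnj l * (Dq z v * w))"

lemma u_deriv:
  "((\<lambda>y. u12 l y w) has_derivative Du12 l z w) (at z)"
  "((\<lambda>y. u21 l y w) has_derivative Du21 l z w) (at z)"
  unfolding u12_def u21_def Du12_def[abs_def] Du21_def[abs_def]
  by (intro has_derivative_add has_derivative_diff has_derivative_mult_left
      has_derivative_mult_right has_derivative_cnj p_deriv q_deriv)+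

lemma rotated_parameter: "l \<in> sphere 0 1 \<Longrightarrow> - \<i> * l \<in> sphere 0 1"
  by (simp add: norm_mult)

text \<open>Leibniz rule for the tensors. In \<open>fr 2 1\<close> the diagonal contributions of the
  two factors cancel, because \<open>a\<close> is the same at both parameters; this is horizontality
  of the lift. In \<open>fr 1 1\<close> and \<open>fr 2 2\<close> they add up to
  \<open>2 * a\<close> and \<open>- 2 * a\<close>.\<close>

lemma fr_deriv:
  assumes l: "l \<in> sphere 0 1"
  defines "l' \<equiv> - \<i> * l"
  shows "(fr 1 1 l has_derivative (\<lambda>h. (2 * a z h) *s fr 1 1 l z +
      (- cnj (a12 z l' h)) *s fr 1 2 l z + (- cnj (a12 z l h)) *s fr 2 1 l z)) (at z)"
    "(fr 2 1 l has_derivative (\<lambda>h. a12 z l h *s fr 1 1 l z +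
      (- cnj (a12 z l' h)) *s fr 2 2 l z)) (at z)"
    "(fr 2 2 l has_derivative (\<lambda>h. (- 2 * a z h) *s fr 2 2 l z +
      a12 z l h *s fr 1 2 l z + a12 z l' h *s fr 2 1 l z)) (at z)"
proof -
  have l': "l' \<in> sphere 0 1" unfolding l'_def by (rule rotated_parameter[OF l])
  note D = bounded_bilinear.FDERIV[OF bounded_bilinear_segre]
  show "(fr 1 1 l has_derivative (\<lambda>h. (2 * a z h) *s fr 1 1 l z +
      (- cnj (a12 z l' h)) *s fr 1 2 l z + (- cnj (a12 z l h)) *s fr 2 1 l z)) (at z)"
    using D[OF e_deriv(1)[OF l] e_deriv(1)[OF l']]
    unfolding fr_def[abs_def] l'_def[symmetric] segre_linear
    by (rule has_derivative_eq_rhs) (simp add: fun_eq_iff vec_eq_iff algebra_simps)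
  show "(fr 2 1 l has_derivative (\<lambda>h. a12 z l h *s fr 1 1 l z +
      (- cnj (a12 z l' h)) *s fr 2 2 l z)) (at z)"
    using D[OF e_deriv(2)[OF l] e_deriv(1)[OF l']]
    unfolding fr_def[abs_def] l'_def[symmetric] segre_linear
    by (rule has_derivative_eq_rhs) (simp add: fun_eq_iff vec_eq_iff algebra_simps)
  show "(fr 2 2 l has_derivative (\<lambda>h. (- 2 * a z h) *s fr 2 2 l z +
      a12 z l h *s fr 1 2 l z + a12 z l' h *s fr 2 1 l z)) (at z)"
    using D[OF e_deriv(2)[OF l] e_deriv(2)[OF l']]
    unfolding fr_def[abs_def] l'_def[symmetric] segre_linear
    by (rule has_derivative_eq_rhs) (simp add: fun_eq_iff vec_eq_iff algebra_simps)
qed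

lemma a12_u:
  assumes l: "l \<in> sphere 0 1"
  shows "a12 z l h = u12 l z h" "- cnj (a12 z (- \<i> * l) h) = u21 l z h"
  using a12_eq[OF l, of z h] a12_eq[OF rotated_parameter[OF l], of z h]
  by (simp_all add: u12_def u21_def algebra_simps)

lemma f_hat_fun_eq: "l \<in> sphere 0 1 \<Longrightarrow> f_hat F l = fr 2 1 l"
  by (intro ext f_hat_eq_segre)

lemma f_hat_deriv:
  assumes l: "l \<in> sphere 0 1"
  shows "(f_hat F l has_derivative (\<lambda>h. u12 l z h *s fr 1 1 l z + u21 l z h *s fr 2 2 l z)) (at z)"
  using fr_deriv(2)[OF l, of z] unfolding f_hat_fun_eq[OF l] a12_u[OF l] .

lemma frechet_f_hat:
  assumes l: "l \<in> sphere 0 1"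
  shows "frechet_derivative (f_hat F l) (at z) h = u12 l z h *s fr 1 1 l z + u21 l z h *s fr 2 2 l z"
  by (rule fun_cong[OF frechet_derivative_at[OF f_hat_deriv[OF l], symmetric]])

text \<open>Covariant derivatives; the weights 2 and -2 are those with which \<open>a\<close> acts
  on \<open>fr 1 1\<close> and \<open>fr 2 2\<close>.\<close>

definition Kp :: "complex \<Rightarrow> complex \<Rightarrow> complex" where "Kp z h = Dp z h + 2 * a z h * p z"
definition Kq :: "complex \<Rightarrow> complex \<Rightarrow> complex" where "Kq z h = Dq z h - 2 * a z h * q z"

text \<open>The components \<open>x\<close> and \<open>y\<close> may stay unspecified: they lie
  along the conjugate of the lift and along the lift, both orthogonal to the tangent space of the
  quadric.\<close>

lemma f_hat_second_deriv:
  assumes l: "l \<in> sphere 0 1"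
  obtains x y where "((\<lambda>y. frechet_derivative (f_hat F l) (at y) w) has_derivative
    (\<lambda>v. ((Kp z v * w) * cnj l - cnj (Kq z v * w) * l) *s fr 1 1 l z +
      (\<i> * (l * cnj (Kp z v * w) + cnj l * (Kq z v * w))) *s fr 2 2 l z +
      x v *s fr 1 2 l z + y v *s fr 2 1 l z)) (at z)"
proof
  note D = bounded_bilinear.FDERIV[OF bounded_bilinear_vector_scalar_mult]
  show "((\<lambda>y. frechet_derivative (f_hat F l) (at y) w) has_derivative
    (\<lambda>v. ((Kp z v * w) * cnj l - cnj (Kq z v * w) * l) *s fr 1 1 l z +
      (\<i> * (l * cnj (Kp z v * w) + cnj l * (Kq z v * w))) *s fr 2 2 l z +
      (u12 l z w * (- cnj (a12 z (- \<i> * l) v)) + u21 l z w * a12 z l v) *s fr 1 2 l z +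
      (u12 l z w * (- cnj (a12 z l v)) + u21 l z w * a12 z (- \<i> * l) v) *s fr 2 1 l z)) (at z)"
    unfolding frechet_f_hat[OF l]
  proof (rule has_derivative_eq_rhs[OF has_derivative_add[OF
        D[OF u_deriv(1) fr_deriv(1)[OF l]] D[OF u_deriv(2) fr_deriv(3)[OF l]]]], rule ext)
    fix v
    have "(Kp z v * w) * cnj l - cnj (Kq z v * w) * l = Du12 l z w v + 2 * a z v * u12 l z w"
      "\<i> * (l * cnj (Kp z v * w) + cnj l * (Kq z v * w)) = Du21 l z w v - 2 * a z v * u21 l z w"
      by (simp_all add: Kp_def Kq_def u12_def u21_def Du12_def Du21_def cnj_a algebra_simps)
    then show "u12 l z w *s ((2 * a z v) *s fr 1 1 l z + - cnj (a12 z (- \<i> * l) v) *s fr 1 2 l z +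
          - cnj (a12 z l v) *s fr 2 1 l z) + Du12 l z w v *s fr 1 1 l z +
        (u21 l z w *s ((- 2 * a z v) *s fr 2 2 l z + a12 z l v *s fr 1 2 l z +
          a12 z (- \<i> * l) v *s fr 2 1 l z) + Du21 l z w v *s fr 2 2 l z) =
      ((Kp z v * w) * cnj l - cnj (Kq z v * w) * l) *s fr 1 1 l z +
      (\<i> * (l * cnj (Kp z v * w) + cnj l * (Kq z v * w))) *s fr 2 2 l z +
      (u12 l z w * (- cnj (a12 z (- \<i> * l) v)) + u21 l z w * a12 z l v) *s fr 1 2 l z +
      (u12 l z w * (- cnj (a12 z l v)) + u21 l z w * a12 z (- \<i> * l) v) *s fr 2 1 l z"
      by (simp only:) (simp add: vec_eq_iff algebra_simps)
  qed
qed

section \<open>The induced metric, the Kaehler form and the quadric\<close>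

definition dens :: "complex \<Rightarrow> real" where "dens z = (norm (p z))\<^sup>2 + (norm (q z))\<^sup>2"

lemma dens_pos: "dens z > 0"
proof -
  have "p z \<noteq> 0" using b_d[of z] by (auto simp: p_def)
  then show ?thesis by (simp add: dens_def add_pos_nonneg)
qed

text \<open>Since \<open>d\<close> is the inverse of \<open>b\<close>, the moduli of
  \<open>p\<close> and \<open>q\<close> depend only on those of \<open>b\<close> and
  \<open>z\<close>.\<close>

lemma dens_radial:
  assumes "norm z = norm w"
  shows "dens z = dens w"
proof -
  have d: "norm (d y) = 1 / norm (b y)" for y
  proof -
    have "b y \<noteq> 0" using b_d[of y] by auto
    moreover have "norm (d y) * norm (b y) = 1"
      using arg_cong[OF b_d[of y], of norm] by (simp add: norm_mult mult.commute)
    ultimately show ?thesis by (simp add: eq_divide_eq)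
  qed
  show ?thesis
    by (simp add: dens_def p_def q_def norm_mult norm_power d norm_b_radial[OF assms] assms)
qed

lemma f_hat_norm:
  assumes "l \<in> sphere 0 1"
  shows "herm (f_hat F l z) (f_hat F l z) = 1" "norm (f_hat F l z) = 1"
proof -
  show 1: "herm (f_hat F l z) (f_hat F l z) = 1"
    by (simp add: f_hat_eq_segre[OF assms] herm_fr[OF assms])
  then have "complex_of_real ((norm (f_hat F l z))\<^sup>2) = of_real 1"
    by (simp only: herm_self of_real_1)
  then have "(norm (f_hat F l z))\<^sup>2 = 1" by (simp only: of_real_eq_iff)
  then show "norm (f_hat F l z) = 1"
    using norm_ge_zero[of "f_hat F l z"] by (auto simp: power2_eq_1_iff)
qed

lemma f_hat_horizontal:
  assumes "l \<in> sphere 0 1"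
  shows "herm (frechet_derivative (f_hat F l) (at z) h) (f_hat F l z) = 0"
  by (simp add: frechet_f_hat[OF assms] f_hat_eq_segre[OF assms] herm_add_left herm_scaleC_left
      herm_fr[OF assms])

text \<open>The terms in \<open>l\<^sup>2\<close> and its conjugate cancel between the two
  components, thanks to the shift of the parameter by \<open>- \<i>\<close>. The rest is real, which
  gives conformality and the Lagrangian property at once.\<close>

lemma herm_frechet_f_hat:
  assumes l: "l \<in> sphere 0 1"
  shows "herm (frechet_derivative (f_hat F l) (at z) v) (frechet_derivative (f_hat F l) (at z) w) =
    of_real (2 * dens z * Re (v * cnj w))"
proof -
  have "herm (frechet_derivative (f_hat F l) (at z) v) (frechet_derivative (f_hat F l) (at z) w) =
      u12 l z v * cnj (u12 l z w) + u21 l z v * cnj (u21 l z w)"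
    by (simp add: frechet_f_hat[OF l] herm_add_left herm_add_right herm_scaleC_left
      herm_scaleC_right herm_fr[OF l])
  also have "\<dots> = (l * cnj l) * ((p z * cnj (p z) + q z * cnj (q z)) * (v * cnj w + cnj (v * cnj w)))"
    unfolding u12_def u21_def by (simp add: algebra_simps)
  also have "\<dots> = of_real (2 * dens z * Re (v * cnj w))"
    by (simp only: unit[OF l] dens_def complex_add_cnj of_real_mult of_real_add complex_norm_square
      mult_1_left of_real_numeral) (simp only: mult_ac)
  finally show ?thesis .
qed

lemma fubini_study_f_hat:
  assumes l: "l \<in> sphere 0 1"
  shows "fubini_study (f_hat F l z) (frechet_derivative (f_hat F l) (at z) v)
      (frechet_derivative (f_hat F l) (at z) w) = of_real (2 * dens z * Re (v * cnj w))"
  unfolding fubini_study_def f_hat_norm(1)[OF l] f_hat_horizontal[OF l] herm_frechet_f_hat[OF l]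
  by simp

lemma pullback_metric_f_hat:
  "l \<in> sphere 0 1 \<Longrightarrow> pullback_metric (f_hat F l) z v w = 2 * dens z * Re (v * cnj w)"
  unfolding pullback_metric_def fubini_study_f_hat by (rule Re_complex_of_real)

lemma pullback_kaehler_f_hat: "l \<in> sphere 0 1 \<Longrightarrow> pullback_kaehler (f_hat F l) z v w = 0"
  unfolding pullback_kaehler_def fubini_study_f_hat by (rule Im_complex_of_real)

lemma f_hat_Q2:
  assumes l: "l \<in> sphere 0 1"
  shows "cp_class (f_hat F l z) \<in> Q2"
proof -
  have "f_hat F l z \<noteq> 0" using f_hat_norm(2)[OF l, of z] by auto
  moreover have "(\<Sum>i\<in>UNIV. (f_hat F l z $ i)\<^sup>2) = 0"
    unfolding power2_eq_square f_hat_eq_segre[OF l] fr_def sum_segre_mult by (simp add: det2_def)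
  ultimately show ?thesis unfolding Q2_def by blast
qed

lemma f_hat_horizontal_lift:
  assumes l: "l \<in> sphere 0 1" and S: "\<And>z. S z = cp_class (f_hat F l z)"
  shows "horizontal_lift (f_hat F l) S"
  unfolding horizontal_lift_def differentiable_def
  using S f_hat_norm(2)[OF l] f_hat_horizontal[OF l] f_hat_deriv[OF l] by blast

section \<open>Minimality\<close>

lemma orthogonal_complex:
  fixes v w :: complex
  assumes vw: "Re (v * cnj w) = 0" and eq: "Re (v * cnj v) = Re (w * cnj w)" and "Re (v * cnj v) > 0"
  shows "w = \<i> * v \<or> w = - (\<i> * v)"
proof -
  have "v \<noteq> 0" using assms(3) by auto
  \<comment> \<open>Orthogonality makes the quotient \<open>t\<close> imaginary, and equal lengths
    give it modulus 1.\<close>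
  define t where "t = w / v"
  have w: "w = t * v" using \<open>v \<noteq> 0\<close> by (simp add: t_def)
  have "v * cnj w = cnj t * (v * cnj v)" by (simp add: w)
  also have "v * cnj v = of_real ((norm v)\<^sup>2)" by (rule complex_norm_square[symmetric])
  finally have "Re t * (norm v)\<^sup>2 = 0" using vw by simp
  then have "Re t = 0" using \<open>v \<noteq> 0\<close> by simp
  have "Re (w * cnj w) = Re ((t * cnj t) * (v * cnj v))" by (simp add: w mult_ac)
  also have "\<dots> = (norm t)\<^sup>2 * (norm v)\<^sup>2"
    unfolding complex_norm_square[symmetric] by (simp flip: of_real_mult)
  also have "Re (w * cnj w) = (norm v)\<^sup>2"
    unfolding eq[symmetric] by (simp only: complex_norm_square[symmetric] Re_complex_of_real)
  finally have "(norm t)\<^sup>2 = 1" using \<open>v \<noteq> 0\<close> by simp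
  then have "(Im t)\<^sup>2 = 1" using \<open>Re t = 0\<close> by (simp add: cmod_power2)
  then have "Im t = 1 \<or> Im t = - 1" by (simp add: power2_eq_1_iff)
  then have "t = \<i> \<or> t = - \<i>" using \<open>Re t = 0\<close> by (auto simp: complex_eq_iff)
  then show ?thesis using w by auto
qed

text \<open>A complex linear \<open>K\<close> yields a complex quadratic form, which changes sign
  when \<open>v\<close> is multiplied by \<open>\<i>\<close>; so its trace over an orthonormal basis
  of a conformal metric is 0.\<close>

lemma trace_vanishes:
  fixes K :: "complex \<Rightarrow> complex"
  assumes K: "\<And>h. K (\<i> * h) = \<i> * K h" and w: "w = \<i> * v \<or> w = - (\<i> * v)"
  shows "K v * v + K w * w = 0"
proof -
  have "K (- h) = - K h" for h
    using K[of "\<i> * h"] K[of h] by (simp flip: mult.assoc)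
  with w K[of v] show ?thesis by (auto simp: algebra_simps)
qed

lemma f_hat_minimal:
  assumes l: "l \<in> sphere 0 1"
  shows "zero_mean_curvature_Q2 (f_hat F l)"
  unfolding zero_mean_curvature_Q2_def
proof (intro allI impI, elim conjE)
  fix z v w n
  assume vw: "pullback_metric (f_hat F l) z v v = 1" "pullback_metric (f_hat F l) z w w = 1"
    "pullback_metric (f_hat F l) z v w = 0" and n: "n \<in> tangent_Q2 (f_hat F l z)"
  have "w = \<i> * v \<or> w = - (\<i> * v)"
  proof (rule orthogonal_complex)
    show "Re (v * cnj w) = 0"
      using vw(3) dens_pos[of z] by (simp only: pullback_metric_f_hat[OF l] mult_eq_0_iff) simp
    have "2 * dens z * Re (v * cnj v) = 2 * dens z * Re (w * cnj w)"
      using vw by (simp only: pullback_metric_f_hat[OF l])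
    then show "Re (v * cnj v) = Re (w * cnj w)"
      using dens_pos[of z] by simp
    have "2 * dens z * Re (v * cnj v) > 0"
      using vw(1) by (simp only: pullback_metric_f_hat[OF l])
    then show "Re (v * cnj v) > 0"
      by (rule zero_less_mult_pos) (use dens_pos[of z] in simp)
  qed
  note w = this
  have K: "Kp z (\<i> * h) = \<i> * Kp z h" "Kq z (\<i> * h) = \<i> * Kq z h" for h
    unfolding Kp_def Kq_def by (rule covariant_p covariant_q)+
  have tr: "Kp z v * v + Kp z w * w = 0" "Kq z v * v + Kq z w * w = 0"
    by (rule trace_vanishes[of "Kp z", OF K(1) w], rule trace_vanishes[of "Kq z", OF K(2) w])
  \<comment> \<open>Being tangent to the quadric, \<open>n\<close> is orthogonal to the lift and, by
    the bilinear condition, to its conjugate, which is \<open>fr 1 2\<close> up to sign.\<close>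
  have eq0: "herm (fr 2 1 l z) n = 0" "herm (fr 1 2 l z) n = 0"
  proof -
    have n': "herm n (fr 2 1 l z) = 0" "(\<Sum>i\<in>UNIV. n $ i * fr 2 1 l z $ i) = 0"
      using n by (simp_all add: tangent_Q2_def f_hat_eq_segre[OF l])
    then show "herm (fr 2 1 l z) n = 0" by (subst herm_commute) simp
    have "cnj (fr 2 1 l z $ i) = - fr 1 2 l z $ i" for i
      unfolding fr_def segre_quat_J[symmetric] quat_J_e[OF l] quat_J_e[OF rotated_parameter[OF l]]
        segre_linear by simp
    then have "fr 1 2 l z $ i * cnj (n $ i) = - cnj (n $ i * fr 2 1 l z $ i)" for i
      by (simp add: mult_ac)
    then have "herm (fr 1 2 l z) n = - cnj (\<Sum>i\<in>UNIV. n $ i * fr 2 1 l z $ i)"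
      by (simp only: herm_def sum_negf cnj_sum)
    then show "herm (fr 1 2 l z) n = 0" by (simp only: n') simp
  qed
  have second: "\<exists>x y. second_deriv (f_hat F l) z v' w' =
      ((Kp z v' * w') * cnj l - cnj (Kq z v' * w') * l) *s fr 1 1 l z +
      (\<i> * (l * cnj (Kp z v' * w') + cnj l * (Kq z v' * w'))) *s fr 2 2 l z +
      x *s fr 1 2 l z + y *s fr 2 1 l z" for v' w'
  proof (rule f_hat_second_deriv[OF l, of w' z])
    fix x y
    assume D: "((\<lambda>y. frechet_derivative (f_hat F l) (at y) w') has_derivative
    (\<lambda>v. ((Kp z v * w') * cnj l - cnj (Kq z v * w') * l) *s fr 1 1 l z +
      (\<i> * (l * cnj (Kp z v * w') + cnj l * (Kq z v * w'))) *s fr 2 2 l z +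
      x v *s fr 1 2 l z + y v *s fr 2 1 l z)) (at z)"
    show ?thesis
      unfolding second_deriv_def frechet_derivative_at[OF D, symmetric] by (intro exI) (rule refl)
  qed
  have s: "herm (second_deriv (f_hat F l) z v' w') n =
      ((Kp z v' * w') * cnj l - cnj (Kq z v' * w') * l) * herm (fr 1 1 l z) n +
      (\<i> * (l * cnj (Kp z v' * w') + cnj l * (Kq z v' * w'))) * herm (fr 2 2 l z) n" for v' w'
  proof -
    obtain x y where "second_deriv (f_hat F l) z v' w' =
      ((Kp z v' * w') * cnj l - cnj (Kq z v' * w') * l) *s fr 1 1 l z +
      (\<i> * (l * cnj (Kp z v' * w') + cnj l * (Kq z v' * w'))) *s fr 2 2 l z +
      x *s fr 1 2 l z + y *s fr 2 1 l z"
      using second[of v' w'] by (elim exE)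
    then show ?thesis
      by (simp only: herm_add_left herm_scaleC_left eq0 mult_zero_right add_0_right)
  qed
  \<comment> \<open>Both surviving coefficients are real-linear in \<open>Kp z v * v\<close> and
    \<open>Kq z v * v\<close>, so the contributions of \<open>v\<close> and \<open>w\<close>
    cancel.\<close>
  have Kw: "Kp z w * w = - (Kp z v * v)" "Kq z w * w = - (Kq z v * v)"
    using tr by (simp_all add: add_eq_0_iff)
  have "herm (second_deriv (f_hat F l) z v v + second_deriv (f_hat F l) z w w) n = 0"
    unfolding herm_add_left s Kw complex_cnj_minus by (simp only: algebra_simps) simp
  then show "Re (herm (second_deriv (f_hat F l) z v v + second_deriv (f_hat F l) z w w) n) = 0"
    by simp
qed

lemma f_hat_minimal_lagrangian:
  assumes l: "l \<in> sphere 0 1" and S: "\<And>z. S z = cp_class (f_hat F l z)"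
  shows "minimal_lagrangian_Q2 S"
  unfolding minimal_lagrangian_Q2_def
proof (intro conjI exI[of _ "f_hat F l"] allI impI)
  show "range S \<subseteq> Q2" using f_hat_Q2[OF l] S by auto
  show "horizontal_lift (f_hat F l) S" by (rule f_hat_horizontal_lift[OF assms])
  show "zero_mean_curvature_Q2 (f_hat F l)" by (rule f_hat_minimal[OF l])
  fix z v w h :: complex
  show "pullback_kaehler (f_hat F l) z v w = 0" by (rule pullback_kaehler_f_hat[OF l])
  show "(\<lambda>y. frechet_derivative (f_hat F l) (at y) h) differentiable at z"
    by (rule f_hat_second_deriv[OF l, of h z]) (rule differentiableI)
  assume "h \<noteq> 0"
  then have "Re (h * cnj h) > 0" unfolding complex_norm_square[symmetric] by simp
  then show "pullback_metric (f_hat F l) z h h > 0"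
    unfolding pullback_metric_f_hat[OF l] using dens_pos[of z] by (intro mult_pos_pos) simp_all
qed

section \<open>Discrete rotations of the lift\<close>

lemma f_hat_rotation:
  assumes l: "l \<in> sphere 0 1"
  shows "f_hat F l (refl_rot k m z) = rot_matrix k m *v f_hat F l (cnj z)"
proof -
  define t where "t = 2 * pi * real m / real (k + 2)"
  define \<omega> where "\<omega> = cis t"
  have \<omega>: "norm \<omega> = 1" "\<omega> * cnj \<omega> = 1" using unit[of \<omega>] by (simp_all add: \<omega>_def)
  have rot: "refl_rot k m z = \<omega> * cnj z"
    unfolding refl_rot_def \<omega>_def t_def cis_conv_exp by (simp add: mult_ac)
  have "real (k + 2) * t = 2 * pi * real m"
    unfolding t_def by (metis nonzero_eq_divide_eq mult.commute of_nat_eq_0_iff add_eq_0_iff_both_eq_0 zero_neq_numeral)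
  then have "\<omega> ^ (k + 2) = cis (2 * pi * real m)"
    unfolding \<omega>_def Complex.DeMoivre[of t "k + 2"] by (simp only:)
  moreover have "cis (2 * pi * real m) = 1" by (rule cis_multiple_2pi) simp
  \<comment> \<open>A root of unity of order dividing \<open>k + 2\<close> satisfies the relations
    of \<open>frame_symmetry\<close> with \<open>\<mu> = 1\<close> and
    \<open>\<epsilon> = \<omega>\<close>, so the loop parameter stays fixed.\<close>
  ultimately have "\<omega> ^ (k + 1) * \<omega> = 1" by (simp add: mult_ac)
  then obtain \<kappa> where \<kappa>: "\<kappa> * cnj \<kappa> = 1"
    "\<And>l. l \<in> sphere 0 1 \<Longrightarrow> f (\<omega> * cnj z) l = f (cnj z) l * \<kappa>"
    "\<And>l. l \<in> sphere 0 1 \<Longrightarrow> g (\<omega> * cnj z) l = \<omega> * g (cnj z) l * cnj \<kappa>"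
    using frame_symmetry[OF \<omega>(1) norm_one \<omega>(1), of "cnj z"] by (metis mult_1_left)
  have \<omega>_eq: "cnj \<omega> = of_real (cos t) - \<i> * of_real (sin t)" "\<omega> = of_real (cos t) + \<i> * of_real (sin t)"
    by (simp_all add: \<omega>_def complex_eq_iff)
  define x y where "x = e 2 (cnj z) l" and "y = e 1 (cnj z) (- \<i> * l)"
  define x' y' where "x' = e 2 (\<omega> * cnj z) l" and "y' = e 1 (\<omega> * cnj z) (- \<i> * l)"
  note nth = e_nth[OF l] e_nth[OF rotated_parameter[OF l]] \<kappa>(2,3)[OF l]
    \<kappa>(2,3)[OF rotated_parameter[OF l]]
  \<comment> \<open>The diagonal factor enters as \<open>cnj \<kappa>\<close> through
    \<open>e 2\<close> and as \<open>\<kappa>\<close> through \<open>e 1\<close>, so it cancels in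
    the tensor. What remains is \<open>\<omega>\<close> on one product and
    \<open>cnj \<omega>\<close> on another, a rotation by \<open>t\<close> of coordinates 3 and
    4.\<close>
  have "x' $ 2 * y' $ 1 = (\<kappa> * cnj \<kappa>) * (x $ 2 * y $ 1)"
    "x' $ 1 * y' $ 2 = (\<omega> * cnj \<omega>) * (\<kappa> * cnj \<kappa>) * (x $ 1 * y $ 2)"
    "x' $ 1 * y' $ 1 = \<omega> * (\<kappa> * cnj \<kappa>) * (x $ 1 * y $ 1)"
    "x' $ 2 * y' $ 2 = cnj \<omega> * (\<kappa> * cnj \<kappa>) * (x $ 2 * y $ 2)"
    unfolding x_def y_def x'_def y'_def nth by (simp_all add: mult_ac)
  then have prods: "x' $ 2 * y' $ 1 = x $ 2 * y $ 1" "x' $ 1 * y' $ 2 = x $ 1 * y $ 2"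
    "x' $ 1 * y' $ 1 = (of_real (cos t) + \<i> * of_real (sin t)) * (x $ 1 * y $ 1)"
    "x' $ 2 * y' $ 2 = (of_real (cos t) - \<i> * of_real (sin t)) * (x $ 2 * y $ 2)"
    by (simp_all only: \<kappa>(1) \<omega>(2) mult_1_left mult_1_right flip: \<omega>_eq)
  have "segre x' y' = rot_matrix k m *v segre x y"
    unfolding vec_eq_iff forall_4 matrix_vector_mult_def rot_matrix_def t_def[symmetric] Let_def
      sum_4 vec_lambda_beta vector_4 segre_nth prods
    by (simp add: algebra_simps)
  then show ?thesis
    unfolding rot f_hat_eq_segre[OF l] fr_def x_def y_def x'_def y'_def .
qed

end

theorem proposition3p6:
  fixes k :: nat and c :: complex
    and \<Phi> F B :: "complex \<Rightarrow> complex \<Rightarrow> complex^2^2"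
    and f :: "complex \<Rightarrow> complex \<Rightarrow> (complex^4) set"
  assumes c: "c \<in> UNIV - (sphere 0 1 \<union> {0})"
    and ode: "\<And>z l. l \<in> sphere 0 1 \<Longrightarrow>
        ((\<lambda>w. \<Phi> w l) has_derivative (\<lambda>h. \<Phi> z l ** radial_potential k c z l h)) (at z)"
    and init: "\<And>l. l \<in> sphere 0 1 \<Longrightarrow> \<Phi> 0 l = mat 1"
    and F_loop: "\<And>z. F z \<in> loop_SU2"
    and F_C1: "C1_into_loops F"
    and B_loop: "\<And>z. B z \<in> loop_plus_SL2"
    and iwasawa: "\<And>z l. l \<in> sphere 0 1 \<Longrightarrow> \<Phi> z l = F z l ** B z l"
    and f_def: "\<And>l z. f l z = cp_class (f_hat F l z)"
  shows "\<forall>l\<in>sphere 0 1.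
      minimal_lagrangian_Q2 (f l) \<and>
      horizontal_lift (f_hat F l) (f l) \<and>
      (\<forall>m\<in>{0..k + 1}. \<forall>z.
         f_hat F l (refl_rot k m z) = rot_matrix k m *v f_hat F l (cnj z)) \<and>
      (\<exists>u :: complex \<Rightarrow> real.
         (\<forall>z v w. pullback_metric (f_hat F l) z v w = 2 * exp (u z) * Re (v * cnj w)) \<and>
         (\<forall>z w. norm z = norm w \<longrightarrow> u z = u w))"
proof
  fix l :: complex assume l: "l \<in> sphere 0 1"
  interpret frame: radial_frame k c \<Phi> F B
    by unfold_locales (fact ode init F_loop F_C1 B_loop iwasawa)+
  \<comment> \<open>Comparing \<open>pullback_metric_f_hat\<close> with the required form of the
    metric gives \<open>exp (u z) = frame.dens z\<close>.\<close>
  define u where "u z = ln (frame.dens z)" for z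
  have "pullback_metric (f_hat F l) z v w = 2 * exp (u z) * Re (v * cnj w)" for z v w
    by (simp add: u_def frame.dens_pos frame.pullback_metric_f_hat[OF l] del: complex_cnj_mult)
  moreover have "u z = u w" if "norm z = norm w" for z w
    unfolding u_def by (simp only: frame.dens_radial[OF that])
  ultimately show "minimal_lagrangian_Q2 (f l) \<and>
      horizontal_lift (f_hat F l) (f l) \<and>
      (\<forall>m\<in>{0..k + 1}. \<forall>z.
         f_hat F l (refl_rot k m z) = rot_matrix k m *v f_hat F l (cnj z)) \<and>
      (\<exists>u :: complex \<Rightarrow> real.
         (\<forall>z v w. pullback_metric (f_hat F l) z v w = 2 * exp (u z) * Re (v * cnj w)) \<and>
         (\<forall>z w. norm z = norm w \<longrightarrow> u z = u w))"
    using frame.f_hat_minimal_lagrangian[OF l f_def] frame.f_hat_horizontal_lift[OF l f_def]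
      frame.f_hat_rotation[OF l] by blast
qed

end
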